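(* Let $p\in\{0,1\}$ and let the $m_1\times m_2$, $m_1\times m_1$ and $m_2\times m_2$ matrix functions $v(x,t)$, $\rho_1(x,t)$, $\rho_2(x,t)$ satisfy in $D$ the local matrix dispersionless equation $$v_{tx}=\tfrac12(\rho_1v+v\rho_2),\qquad (\rho_1)_x=\tfrac{(-1)^p}2(vv^* )_t,\qquad (\rho_2)_x=\tfrac{(-1)^p}2(v^*v)_t$$ and the equalities $\rho_i(x,t)=\rho_i(x,t)^*$ ($i=1,2$), and let $v_t$ be continuous in $D$. Let $n\in\mathbb N$ and let the parameter matrices $A$ ($n\times n$, $\det A\ne0$), $S(0,0)=S(0,0)^*$ ($n\times n$, $\det S(0,0)\neq0$) and $\Pi(0,0)$ ($n\times m$) satisfy $$AS(0,0)-S(0,0)A^*=\mathrm i\,\Pi(0,0)j^{p+1}\Pi(0,0)^*.$$ Then, at the points of $D$ where $S(x,t)$ is invertible, the matrix functions $\widetilde v$, $\widetilde\rho_1$, $\widetilde\rho_2$ given by $$\widetilde V=V+\frac{\mathrm i}2\big(j\Pi^*S^{-1}\Pi-\Pi^*S^{-1}\Pi j\big),\qquad \widetilde v=\begin{bmatrix}I_{m_1}&0\end{bmatrix}\widetilde V\begin{bmatrix}0\\ I_{m_2}\end{bmatrix},\qquad \begin{bmatrix}\widetilde\rho_1&0\\0&\widetilde\rho_2\end{bmatrix}=\frac1{2\mathrm i}\big(\widetilde Q_{-1}j+j\widetilde Q_{-1}\big),$$ $$\widetilde Q_{-1}=(I_m-\mathrm i j^{p+1}\Pi^*S^{-1}A^{-1}\Pi)(\mathrm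 i jR-j^pV_t)(I_m+\mathrm i j^{p+1}\Pi^*(A^* )^{-1}S^{-1}\Pi)$$ satisfy the local matrix dispersionless equation $$\widetilde v_{tx}=\tfrac12(\widetilde\rho_1\widetilde v+\widetilde v\widetilde\rho_2),\qquad (\widetilde\rho_1)_x=\tfrac{(-1)^p}2(\widetilde v\widetilde v^* )_t,\qquad (\widetilde\rho_2)_x=\tfrac{(-1)^p}2(\widetilde v^*\widetilde v)_t$$ and the equalities $\widetilde\rho_i(x,t)=\widetilde\rho_i(x,t)^*$ ($i=1,2$). The corresponding Darboux matrix $w_A$ takes the form $$w_A(x,t,\lambda)=I_m-\mathrm i j^{p+1}\Pi(x,t)^*S(x,t)^{-1}(A-\lambda I_n)^{-1}\Pi(x,t);$$ that is, if $w$ satisfies $w_x=Gw$, $w_t=Fw$, then $\widetilde w=w_Aw$ satisfies $\widetilde w_x=\widetilde G\widetilde w$, $\widetilde w_t=\widetilde F\widetilde w$ (for $\lambda\notin\{0\}\cup\sigma(A)$).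
   Context: Notation. $m_1,m_2\ge1$, $m=m_1+m_2$, $j=\begin{bmatrix}I_{m_1}&0\\0&-I_{m_2}\end{bmatrix}$; subscripts $x,t$ denote partial derivatives; $^*$ is the conjugate transpose; all matrices are complex. The domain is $D=\{(x,t):\ a_1<x<a_2,\ b_1<t<b_2\}$ with $-\infty\le a_1<0<a_2\le\infty$, $-\infty\le b_1<0<b_2\le\infty$. Set $$R=\mathrm{diag}\{\rho_1,\rho_2\},\qquad V=\begin{bmatrix}0&v\\ v^*&0\end{bmatrix},\qquad q_1=-\tfrac{\mathrm i}4j,\quad q_0=\tfrac{\mathrm i}2j^{p+1}V,\quad Q_{-1}=\mathrm i jR-j^pV_t.$$ The matrix functions $\Pi(x,t)$ and $S(x,t)$ are determined by the initial values $\Pi(0,0)$, $S(0,0)$ and the (compatible) linear systems $$\Pi_x=A\Pi q_1+\Pi q_0,\qquad \Pi_t=A^{-1}\Pi Q_{-1},$$ $$S_x=\tfrac14\Pi j^p\Pi^*,\qquad S_t=A^{-1}\Pi\big(j^pR+(-1)^{p+1}\mathrm i jV_t\big)\Pi^*(A^* )^{-1}.$$ Auxiliary systems: $G=\frac{\mathrm i}4\lambda j-\frac{\mathrm i}2j^{p+1}V$, $F=\frac1\lambda(-\mathrm i jR+j^pV_t)$; $\widetilde G,\widetilde F$ are obtained from $G,F$ by replacing $V,R$ with $\widetilde V$ and $\widetilde R=\mathrm{diag}\{\widetilde\rho_1,\widetilde\rho_2\}$. The Darboux matrix is the matrix function that transforms solutions of the initial auxiliary systems into solutions of the transformed ones by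 left multiplication. *)

theory Defs
  imports "HOL-Analysis.Analysis"
begin

text \<open>
  An \<open>a \<times> b\<close> complex matrix has type \<open>complex^'b^'a\<close>. The index type of \<open>m = m\<^sub>1 + m\<^sub>2\<close> is the sum
  type \<open>'m1 + 'm2\<close>, and matrix functions of \<open>(x, t)\<close> are curried. The library multiplication \<open>*\<close>
  and power \<open>^\<close> on vectors are componentwise, hence the scalar multiple and the power below.
\<close>

definition cscale :: "complex \<Rightarrow> complex^'b^'a \<Rightarrow> complex^'b^'a" (infixr "*\<^sub>C" 75) where
  "c *\<^sub>C M = map_matrix (\<lambda>z. c * z) M"

definition mpow :: "complex^'a^'a \<Rightarrow> nat \<Rightarrow> complex^'a^'a" where
  "mpow M k = (((**) M) ^^ k) (mat 1)"

definition ctrans :: "complex^'b^'a \<Rightarrow> complex^'a^'b" where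
  "ctrans M = map_matrix cnj (transpose M)"

definition spectrum :: "complex^'a^'a \<Rightarrow> complex set" where
  "spectrum A = {l. \<not> invertible (A - mat l)}"

definition block_mat ::
  "complex^'m1^'m1 \<Rightarrow> complex^'m2^'m1 \<Rightarrow> complex^'m1^'m2 \<Rightarrow> complex^'m2^'m2
     \<Rightarrow> complex^('m1::finite + 'm2::finite)^('m1 + 'm2)" where
  "block_mat a b c d = (\<chi> i k.
     case i of
       Inl i1 \<Rightarrow> (case k of Inl k1 \<Rightarrow> a $ i1 $ k1 | Inr k2 \<Rightarrow> b $ i1 $ k2)
     | Inr i2 \<Rightarrow> (case k of Inl k1 \<Rightarrow> c $ i2 $ k1 | Inr k2 \<Rightarrow> d $ i2 $ k2))"

text \<open>The rectangular matrices \<open>[I 0]\<close> and \<open>[0; I]\<close> that cut out the upper right block.\<close>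

definition row_I0 :: "complex^('m1::finite + 'm2::finite)^'m1" where
  "row_I0 = (\<chi> i k. case k of Inl k1 \<Rightarrow> if i = k1 then 1 else 0 | Inr k2 \<Rightarrow> 0)"

definition col_0I :: "complex^'m2^('m1::finite + 'm2::finite)" where
  "col_0I = (\<chi> i k. case i of Inl i1 \<Rightarrow> 0 | Inr i2 \<Rightarrow> if i2 = k then 1 else 0)"

definition jmat :: "complex^('m1::finite + 'm2::finite)^('m1 + 'm2)" where
  "jmat = block_mat (mat 1) 0 0 (- mat 1)"

definition Vmat :: "(real \<Rightarrow> real \<Rightarrow> complex^'m2^'m1)
    \<Rightarrow> real \<Rightarrow> real \<Rightarrow> complex^('m1::finite + 'm2::finite)^('m1 + 'm2)" where
  "Vmat v x t = block_mat 0 (v x t) (ctrans (v x t)) 0"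

definition Rmat :: "(real \<Rightarrow> real \<Rightarrow> complex^'m1^'m1) \<Rightarrow> (real \<Rightarrow> real \<Rightarrow> complex^'m2^'m2)
    \<Rightarrow> real \<Rightarrow> real \<Rightarrow> complex^('m1::finite + 'm2::finite)^('m1 + 'm2)" where
  "Rmat r1 r2 x t = block_mat (r1 x t) 0 0 (r2 x t)"

definition dt :: "(real \<Rightarrow> real \<Rightarrow> 'a::real_normed_vector) \<Rightarrow> real \<Rightarrow> real \<Rightarrow> 'a" where
  "dt f x t = vector_derivative (\<lambda>s. f x s) (at t)"

definition has_dx :: "(real \<Rightarrow> real \<Rightarrow> 'a::real_normed_vector) \<Rightarrow> 'a \<Rightarrow> real \<Rightarrow> real \<Rightarrow> bool" where
  "has_dx f d x t \<longleftrightarrow> ((\<lambda>y. f y t) has_vector_derivative d) (at x)"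

definition has_dt :: "(real \<Rightarrow> real \<Rightarrow> 'a::real_normed_vector) \<Rightarrow> 'a \<Rightarrow> real \<Rightarrow> real \<Rightarrow> bool" where
  "has_dt f d x t \<longleftrightarrow> ((\<lambda>s. f x s) has_vector_derivative d) (at t)"

definition rect :: "ereal \<Rightarrow> ereal \<Rightarrow> ereal \<Rightarrow> ereal \<Rightarrow> (real \<times> real) set" where
  "rect a1 a2 b1 b2 = {(x, t). a1 < ereal x \<and> ereal x < a2 \<and> b1 < ereal t \<and> ereal t < b2}"

text \<open>
  The local matrix dispersionless equation on \<open>U\<close>, with classical derivatives; \<open>v\<^sub>t\<^sub>x\<close> is read as
  \<open>(v\<^sub>t)\<^sub>x\<close>. Differentiability of \<open>v\<close> in \<open>t\<close> is explicit because \<open>dt\<close> is arbitrary where no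
  derivative exists; it makes the products \<open>v v\<^sup>*\<close> and \<open>v\<^sup>* v\<close> differentiable in \<open>t\<close> as well.
  The derivatives at a point of \<open>U\<close> involve nearby points on the same coordinate lines only.
\<close>

definition dispersionless ::
  "nat \<Rightarrow> (real \<times> real) set \<Rightarrow> (real \<Rightarrow> real \<Rightarrow> complex^'m2^'m1)
    \<Rightarrow> (real \<Rightarrow> real \<Rightarrow> complex^'m1^'m1) \<Rightarrow> (real \<Rightarrow> real \<Rightarrow> complex^'m2^'m2) \<Rightarrow> bool" where
  "dispersionless p U v r1 r2 \<longleftrightarrow> (\<forall>(x, t) \<in> U.
     (\<lambda>s. v x s) differentiable (at t) \<and>
     has_dx (dt v) ((1/2) *\<^sub>R (r1 x t ** v x t + v x t ** r2 x t)) x t \<and>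
     has_dx r1 (((-1)^p / 2) *\<^sub>R dt (\<lambda>y s. v y s ** ctrans (v y s)) x t) x t \<and>
     has_dx r2 (((-1)^p / 2) *\<^sub>R dt (\<lambda>y s. ctrans (v y s) ** v y s) x t) x t)"

definition selfadjoint_on ::
  "(real \<times> real) set \<Rightarrow> (real \<Rightarrow> real \<Rightarrow> complex^'a^'a) \<Rightarrow> bool" where
  "selfadjoint_on U r \<longleftrightarrow> (\<forall>(x, t) \<in> U. r x t = ctrans (r x t))"

text \<open>The coefficients and systems below take the full matrices \<open>V\<close> and \<open>R\<close> as arguments.\<close>

definition q1 :: "complex^('m1::finite + 'm2::finite)^('m1 + 'm2)" where
  "q1 = (- \<i> / 4) *\<^sub>C jmat"

definition q0 :: "nat \<Rightarrow> (real \<Rightarrow> real \<Rightarrow> complex^('m1::finite + 'm2::finite)^('m1 + 'm2))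
    \<Rightarrow> real \<Rightarrow> real \<Rightarrow> complex^('m1 + 'm2)^('m1 + 'm2)" where
  "q0 p V x t = (\<i> / 2) *\<^sub>C (mpow jmat (p + 1) ** V x t)"

definition Qm1 :: "nat \<Rightarrow> (real \<Rightarrow> real \<Rightarrow> complex^('m1::finite + 'm2::finite)^('m1 + 'm2))
    \<Rightarrow> (real \<Rightarrow> real \<Rightarrow> complex^('m1 + 'm2)^('m1 + 'm2))
    \<Rightarrow> real \<Rightarrow> real \<Rightarrow> complex^('m1 + 'm2)^('m1 + 'm2)" where
  "Qm1 p V R x t = \<i> *\<^sub>C (jmat ** R x t) - mpow jmat p ** dt V x t"

definition Pi_system :: "nat \<Rightarrow> (real \<times> real) set
    \<Rightarrow> (real \<Rightarrow> real \<Rightarrow> complex^('m1::finite + 'm2::finite)^('m1 + 'm2))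
    \<Rightarrow> (real \<Rightarrow> real \<Rightarrow> complex^('m1 + 'm2)^('m1 + 'm2))
    \<Rightarrow> complex^'n^'n \<Rightarrow> (real \<Rightarrow> real \<Rightarrow> complex^('m1 + 'm2)^'n) \<Rightarrow> bool" where
  "Pi_system p U V R A P \<longleftrightarrow> (\<forall>(x, t) \<in> U.
     has_dx P (A ** P x t ** q1 + P x t ** q0 p V x t) x t \<and>
     has_dt P (matrix_inv A ** P x t ** Qm1 p V R x t) x t)"

definition S_system :: "nat \<Rightarrow> (real \<times> real) set
    \<Rightarrow> (real \<Rightarrow> real \<Rightarrow> complex^('m1::finite + 'm2::finite)^('m1 + 'm2))
    \<Rightarrow> (real \<Rightarrow> real \<Rightarrow> complex^('m1 + 'm2)^('m1 + 'm2))
    \<Rightarrow> complex^'n^'n \<Rightarrow> (real \<Rightarrow> real \<Rightarrow> complex^('m1 + 'm2)^'n)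
    \<Rightarrow> (real \<Rightarrow> real \<Rightarrow> complex^'n^'n) \<Rightarrow> bool" where
  "S_system p U V R A P S \<longleftrightarrow> (\<forall>(x, t) \<in> U.
     has_dx S ((1/4) *\<^sub>R (P x t ** mpow jmat p ** ctrans (P x t))) x t \<and>
     has_dt S (matrix_inv A ** P x t
                 ** (mpow jmat p ** R x t + ((-1)^(p + 1) * \<i>) *\<^sub>C (jmat ** dt V x t))
                 ** ctrans (P x t) ** matrix_inv (ctrans A)) x t)"

definition V_tilde :: "(real \<Rightarrow> real \<Rightarrow> complex^('m1::finite + 'm2::finite)^('m1 + 'm2))
    \<Rightarrow> (real \<Rightarrow> real \<Rightarrow> complex^('m1 + 'm2)^'n) \<Rightarrow> (real \<Rightarrow> real \<Rightarrow> complex^'n^'n)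
    \<Rightarrow> real \<Rightarrow> real \<Rightarrow> complex^('m1 + 'm2)^('m1 + 'm2)" where
  "V_tilde V P S x t = V x t + (\<i> / 2) *\<^sub>C
     (jmat ** ctrans (P x t) ** matrix_inv (S x t) ** P x t
      - ctrans (P x t) ** matrix_inv (S x t) ** P x t ** jmat)"

definition Qm1_tilde :: "nat \<Rightarrow> (real \<Rightarrow> real \<Rightarrow> complex^('m1::finite + 'm2::finite)^('m1 + 'm2))
    \<Rightarrow> (real \<Rightarrow> real \<Rightarrow> complex^('m1 + 'm2)^('m1 + 'm2))
    \<Rightarrow> complex^'n^'n \<Rightarrow> (real \<Rightarrow> real \<Rightarrow> complex^('m1 + 'm2)^'n)
    \<Rightarrow> (real \<Rightarrow> real \<Rightarrow> complex^'n^'n)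
    \<Rightarrow> real \<Rightarrow> real \<Rightarrow> complex^('m1 + 'm2)^('m1 + 'm2)" where
  "Qm1_tilde p V R A P S x t =
     (mat 1 - \<i> *\<^sub>C (mpow jmat (p + 1) ** ctrans (P x t) ** matrix_inv (S x t)
                       ** matrix_inv A ** P x t))
     ** (\<i> *\<^sub>C (jmat ** R x t) - mpow jmat p ** dt V x t)
     ** (mat 1 + \<i> *\<^sub>C (mpow jmat (p + 1) ** ctrans (P x t) ** matrix_inv (ctrans A)
                       ** matrix_inv (S x t) ** P x t))"

definition aux_G :: "nat \<Rightarrow> (real \<Rightarrow> real \<Rightarrow> complex^('m1::finite + 'm2::finite)^('m1 + 'm2))
    \<Rightarrow> complex \<Rightarrow> real \<Rightarrow> real \<Rightarrow> complex^('m1 + 'm2)^('m1 + 'm2)" where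
  "aux_G p V l x t = (\<i> / 4 * l) *\<^sub>C jmat - (\<i> / 2) *\<^sub>C (mpow jmat (p + 1) ** V x t)"

definition aux_F :: "nat \<Rightarrow> (real \<Rightarrow> real \<Rightarrow> complex^('m1::finite + 'm2::finite)^('m1 + 'm2))
    \<Rightarrow> (real \<Rightarrow> real \<Rightarrow> complex^('m1 + 'm2)^('m1 + 'm2))
    \<Rightarrow> complex \<Rightarrow> real \<Rightarrow> real \<Rightarrow> complex^('m1 + 'm2)^('m1 + 'm2)" where
  "aux_F p V R l x t =
     (1 / l) *\<^sub>C ((- \<i>) *\<^sub>C (jmat ** R x t) + mpow jmat p ** dt V x t)"

text \<open>Solutions may have any number of columns: one for vectors, \<open>m\<close> for fundamental solutions.\<close>

definition solves_aux :: "(real \<times> real) set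
    \<Rightarrow> (real \<Rightarrow> real \<Rightarrow> complex^'m^'m) \<Rightarrow> (real \<Rightarrow> real \<Rightarrow> complex^'m^'m)
    \<Rightarrow> (real \<Rightarrow> real \<Rightarrow> complex^'k^'m) \<Rightarrow> bool" where
  "solves_aux U G F w \<longleftrightarrow> (\<forall>(x, t) \<in> U.
     has_dx w (G x t ** w x t) x t \<and> has_dt w (F x t ** w x t) x t)"

definition w_A :: "nat \<Rightarrow> complex^'n^'n \<Rightarrow> (real \<Rightarrow> real \<Rightarrow> complex^('m1::finite + 'm2::finite)^'n)
    \<Rightarrow> (real \<Rightarrow> real \<Rightarrow> complex^'n^'n)
    \<Rightarrow> real \<Rightarrow> real \<Rightarrow> complex \<Rightarrow> complex^('m1 + 'm2)^('m1 + 'm2)" where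
  "w_A p A P S x t l =
     mat 1 - \<i> *\<^sub>C (mpow jmat (p + 1) ** ctrans (P x t) ** matrix_inv (S x t)
                     ** matrix_inv (A - mat l) ** P x t)"

end

theory Submission
  imports Defs
begin

text \<open>
  Write \<open>j\<close> for the signature matrix, \<open>J = j^p\<close>, \<open>K = j^(p+1)\<close>, \<open>\<epsilon> = (-1)^p\<close>,
  \<open>Q = \<i> j R - J V\<^sub>t\<close> and \<open>G\<^sub>0 = - (\<i>/2) K V\<close>. The dispersionless equation is the zero curvature condition
  of the two auxiliary systems: since \<open>V\<close> anticommutes and \<open>R\<close> commutes with \<open>j\<close>, the equation
  \<open>Q\<^sub>x = [G\<^sub>0, Q]\<close> splits into a \<open>j\<close>-diagonal part, which is \<open>R\<^sub>x = (\<epsilon>/2) (V^2)\<^sub>t\<close>, and an off-diagonal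
  part, which is \<open>V\<^sub>t\<^sub>x = (V R + R V)/2\<close>. So it is enough to show that the transformed matrix
  \<open>Q'\<close> has again the form \<open>\<i> j R' - J V'\<^sub>t\<close> and solves \<open>Q'\<^sub>x = [G'\<^sub>0, Q']\<close>.
  
  Everything rests on the identity \<open>A S - S A\<^sup>* = \<i> \<Pi> K \<Pi>\<^sup>*\<close>. Its two sides have the same derivatives in
  \<open>x\<close> and in \<open>t\<close> (\<open>lyapunov_x\<close>, \<open>lyapunov_t\<close>), so it spreads from the origin to the whole rectangle along
  a broken line with two legs; the same argument gives \<open>S = S\<^sup>*\<close>. Where \<open>S\<close> is invertible the identity
  moves \<open>A\<^sup>*\<close> and its inverse past \<open>S\<close>'s inverse, and this turns the derivatives of \<open>B = K \<Pi>\<^sup>* S\<^sup>-\<^sup>1\<close> into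
    \<open>B\<^sub>x = (\<i>/4) j B A - (\<i>/2) K V' B\<close>  and  \<open>B\<^sub>t = - Q' B A\<^sup>-\<^sup>1\<close>
  (\<open>B_x\<close>, \<open>B_t\<close>), where \<open>Q' = w\<^sub>0 Q w\<^sub>0\<^sup>-\<^sup>1\<close> and \<open>w\<^sub>0\<close> is the Darboux matrix at \<open>\<lambda> = 0\<close>; that the two outer
  factors in the formula for \<open>Q'\<close> are inverse to each other is again the identity
  (\<open>w0_right_inverse\<close>). The formulas for \<open>B\<close> and the resolvent of \<open>A\<close> yield
  \<open>w\<^sub>x = G' w - w G\<close> and \<open>w\<^sub>t = - (1/\<lambda>) (Q' w - w Q)\<close> for \<open>w = I - \<i> B (A - \<lambda>)\<^sup>-\<^sup>1 \<Pi>\<close>, which is the claim on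
  the Darboux matrix once \<open>Q'\<close> is known to come from \<open>V'\<close> and \<open>R'\<close>.
  
  For this last point \<open>(\<Pi>\<^sup>* S\<^sup>-\<^sup>1 \<Pi>)\<^sub>t = \<i> K (Q' - Q)\<close> (\<open>X_t\<close>), so that \<open>- J V'\<^sub>t\<close> is the off-diagonal part of
  \<open>Q'\<close> (\<open>V'_t\<close>), while \<open>\<i> j R'\<close> is its diagonal part by definition. Finally \<open>\<lambda> = 0\<close> in the
  \<open>x\<close>-equation for \<open>w\<close> is a gauge transformation which carries \<open>Q\<^sub>x = [G\<^sub>0, Q]\<close> to \<open>Q'\<^sub>x = [G'\<^sub>0, Q']\<close>
  (\<open>has_vector_derivative_Q'_x\<close>).
\<close>

section \<open>Algebra and calculus of complex matrices\<close>

lemma cscale_nth [simp]: "(c *\<^sub>C M) $ i $ k = c * M $ i $ k"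
  by (simp add: cscale_def map_matrix_def)

lemma cscale_collect:
  "c *\<^sub>C (d *\<^sub>C M) = (c * d) *\<^sub>C M"
  "c *\<^sub>C (M + N) = c *\<^sub>C M + c *\<^sub>C N"
  "c *\<^sub>C (M - N) = c *\<^sub>C M - c *\<^sub>C N"
  "c *\<^sub>C (- M) = (- c) *\<^sub>C M"
  "- (c *\<^sub>C M) = (- c) *\<^sub>C M"
  "1 *\<^sub>C M = M"
  "c *\<^sub>C (0::complex^'b^'a) = 0"
  by (simp_all add: vec_eq_iff algebra_simps)

lemma scaleR_eq_cscale: "r *\<^sub>R (M :: complex^'b^'a) = of_real r *\<^sub>C M"
  by (simp add: vec_eq_iff scaleR_conv_of_real[where 'a=complex])

lemma matrix_mul_distribs:
  fixes A :: "complex^'b^'a" and C :: "complex^'c^'b"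
  shows "A ** (C + C') = A ** C + A ** C'"
  "A ** (C - C') = A ** C - A ** C'"
  "A ** (- C) = - (A ** C)"
  "(A + A') ** C = A ** C + A' ** C"
  "(A - A') ** C = A ** C - A' ** C"
  "(- A) ** C = - (A ** C)"
  "A ** (c *\<^sub>C C) = c *\<^sub>C (A ** C)"
  "(c *\<^sub>C A) ** C = c *\<^sub>C (A ** C)"
  "A ** 0 = (0 :: complex^'c^'a)"
  "0 ** C = (0 :: complex^'c^'a)"
  by (simp_all add: vec_eq_iff matrix_matrix_mult_def sum_distrib_left sum.distrib
      sum_subtractf sum_negf algebra_simps)

lemma ctrans_nth [simp]: "ctrans M $ i $ k = cnj (M $ k $ i)"
  by (simp add: ctrans_def map_matrix_def transpose_def)

lemma ctrans_simps [simp]: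
  "ctrans (ctrans M) = M"
  "ctrans (M + N) = ctrans M + ctrans N"
  "ctrans (M - N) = ctrans M - ctrans N"
  "ctrans (- M) = - ctrans M"
  "ctrans (c *\<^sub>C M) = cnj c *\<^sub>C ctrans M"
  "ctrans (0::complex^'b^'a) = 0"
  "ctrans (mat 1 :: complex^'a^'a) = mat 1"
  by (auto simp: vec_eq_iff mat_def)

lemma ctrans_mult [simp]: "ctrans (M ** N) = ctrans N ** ctrans M"
  by (simp add: vec_eq_iff matrix_matrix_mult_def mult.commute)

lemma matrix_inv_mult:
  fixes A :: "complex^'n^'n"
  assumes "invertible A"
  shows "A ** matrix_inv A = mat 1" "matrix_inv A ** A = mat 1"
  using someI_ex[OF assms[unfolded invertible_def]] by (auto simp: matrix_inv_def)

lemma matrix_inv_unique: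
  fixes A :: "complex^'n^'n"
  assumes "A ** B = mat 1"
  shows "matrix_inv A = B"
proof -
  have "B ** A = mat 1" using assms matrix_left_right_inverse by blast
  with assms have "invertible A" unfolding invertible_def by blast
  from matrix_inv_mult(2)[OF this] assms show ?thesis
    by (metis matrix_mul_assoc matrix_mul_lid matrix_mul_rid)
qed

lemma ctrans_mult_eq_1: "A ** B = mat 1 \<Longrightarrow> ctrans B ** ctrans A = mat 1"
  by (metis ctrans_mult ctrans_simps(7))

lemma matrix_inv_ctrans:
  fixes A :: "complex^'n^'n"
  assumes "invertible A"
  shows "matrix_inv (ctrans A) = ctrans (matrix_inv A)"
  using assms by (simp add: matrix_inv_unique ctrans_mult_eq_1 matrix_inv_mult)

text \<open>
  Products are kept associated to the right. There a rewrite rule for \<open>A ** B\<close> meets the factors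
  \<open>A ** (B ** X)\<close>, and this closes the rule under further factors.
\<close>

lemma mult_eq_extend: "A ** B = C \<Longrightarrow> A ** (B ** X) = C ** X"
  for A :: "complex^'b^'a"
  by (simp add: matrix_mul_assoc)

lemma bounded_bilinear_matrix_mult:
  "bounded_bilinear ((**) :: complex^'b^'a \<Rightarrow> complex^'c^'b \<Rightarrow> complex^'c^'a)"
  unfolding bilinear_conv_bounded_bilinear[symmetric] bilinear_def
  by (auto intro!: linearI simp: matrix_mul_distribs scaleR_eq_cscale)

lemma bounded_linear_ctrans: "bounded_linear (ctrans :: complex^'b^'a \<Rightarrow> _)"
  unfolding linear_conv_bounded_linear[symmetric]
  by (rule linearI) (auto simp: scaleR_eq_cscale)

lemma bounded_linear_cscale: "bounded_linear (cscale c :: complex^'b^'a \<Rightarrow> _)"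
  unfolding linear_conv_bounded_linear[symmetric]
  by (rule linearI) (auto simp: scaleR_eq_cscale cscale_collect mult.commute)

lemmas has_vector_derivative_matrix_mult =
  bounded_bilinear.has_vector_derivative[OF bounded_bilinear_matrix_mult]
lemmas has_vector_derivative_ctrans =
  bounded_linear.has_vector_derivative[OF bounded_linear_ctrans]
lemmas has_vector_derivative_cscale =
  bounded_linear.has_vector_derivative[OF bounded_linear_cscale]
thm has_vector_derivative_matrix_mult has_vector_derivative_ctrans

text \<open>
  The difference quotient is a convenient form of the derivative for the inverse matrix, where the
  quotients are an explicit product of convergent factors.
\<close>

lemma has_vector_derivative_iff_quotient:
  fixes f :: "real \<Rightarrow> 'a::real_normed_vector"
  shows "(f has_vector_derivative d) (at x) \<longleftrightarrow>
    ((\<lambda>y. (1 / (y - x)) *\<^sub>R (f y - f x)) \<longlongrightarrow> d) (at x)"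
proof -
  have "(f has_vector_derivative d) (at x) \<longleftrightarrow>
      ((\<lambda>y. (1 / norm (y - x)) *\<^sub>R (f y - (f x + (y - x) *\<^sub>R d))) \<longlongrightarrow> 0) (at x)"
    unfolding has_vector_derivative_def has_derivative_within by (auto intro: bounded_linear_scaleR_left)
  also have "\<dots> \<longleftrightarrow> ((\<lambda>y. norm ((1 / (y - x)) *\<^sub>R (f y - f x) - d)) \<longlongrightarrow> 0) (at x)"
  proof (subst tendsto_norm_zero_iff[symmetric], rule tendsto_cong)
    have "norm ((1 / norm (y - x)) *\<^sub>R (f y - (f x + (y - x) *\<^sub>R d)))
        = norm ((1 / (y - x)) *\<^sub>R (f y - f x) - d)" if "y \<noteq> x" for y
    proof -
      have "(1 / (y - x)) *\<^sub>R (f y - f x) - d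
          = (1 / (y - x)) *\<^sub>R (f y - (f x + (y - x) *\<^sub>R d))"
        using that by (simp add: scaleR_diff_right scaleR_add_right)
      then show ?thesis by simp
    qed
    then show "\<forall>\<^sub>F y in at x. norm ((1 / norm (y - x)) *\<^sub>R (f y - (f x + (y - x) *\<^sub>R d)))
        = norm ((1 / (y - x)) *\<^sub>R (f y - f x) - d)"
      by (auto simp: eventually_at_filter)
  qed
  also have "\<dots> \<longleftrightarrow> ((\<lambda>y. (1 / (y - x)) *\<^sub>R (f y - f x)) \<longlongrightarrow> d) (at x)"
    by (simp add: tendsto_norm_zero_iff LIM_zero_iff)
  finally show ?thesis .
qed

lemma tendsto_det:
  fixes F :: "'b \<Rightarrow> complex^'n^'n"
  assumes "\<And>i k. ((\<lambda>y. F y $ i $ k) \<longlongrightarrow> L $ i $ k) net"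
  shows "((\<lambda>y. det (F y)) \<longlongrightarrow> det L) net"
  unfolding det_def by (intro tendsto_intros assms)

text \<open>
  Cramer's rule for the columns of the inverse. It gives continuity of the inverse from continuity
  of determinants.
\<close>

lemma matrix_inv_nth:
  fixes A :: "complex^'n^'n"
  assumes "invertible A"
  shows "matrix_inv A $ k $ c =
    det (\<chi> i j. if j = k then axis c 1 $ i else A $ i $ j) / det A"
proof -
  have "A *v (matrix_inv A *v axis c 1) = axis c 1"
    by (simp add: matrix_vector_mul_assoc matrix_inv_mult assms)
  then have "matrix_inv A *v axis c 1 =
      (\<chi> k. det (\<chi> i j. if j = k then axis c 1 $ i else A $ i $ j) / det A)"
    using assms by (subst (asm) cramer) (auto simp: invertible_det_nz)
  moreover have "(matrix_inv A *v axis c 1) $ k = matrix_inv A $ k $ c"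
    by (simp add: matrix_vector_mult_def axis_def if_distrib cong: if_cong)
  ultimately show ?thesis by simp
qed

lemma eventually_invertible:
  fixes F :: "real \<Rightarrow> complex^'n^'n"
  assumes "isCont F x" "invertible (F x)"
  shows "\<forall>\<^sub>F y in nhds x. invertible (F y)"
proof -
  have "((\<lambda>y. det (F y)) \<longlongrightarrow> det (F x)) (nhds x)"
    using assms(1) by (intro tendsto_det tendsto_intros) (simp add: isCont_def tendsto_at_iff_tendsto_nhds)
  then show ?thesis
    using assms(2) by (auto simp: invertible_det_nz dest: tendsto_imp_eventually_ne)
qed

text \<open>
  The quotients converge because of the resolvent-type identity
  \<open>F(y)\<^sup>-\<^sup>1 - F(x)\<^sup>-\<^sup>1 = - F(y)\<^sup>-\<^sup>1 (F(y) - F(x)) F(x)\<^sup>-\<^sup>1\<close>, valid near \<open>x\<close>.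
\<close>

lemma has_vector_derivative_matrix_inv:
  fixes F :: "real \<Rightarrow> complex^'n^'n"
  assumes F: "(F has_vector_derivative F') (at x)" and inv: "invertible (F x)"
  shows "((\<lambda>y. matrix_inv (F y)) has_vector_derivative
           - (matrix_inv (F x) ** F' ** matrix_inv (F x))) (at x)"
proof -
  have cont: "isCont F x"
    using F has_vector_derivative_continuous by blast
  have "\<forall>\<^sub>F y in nhds x. invertible (F y)"
    by (rule eventually_invertible[OF cont inv])
  then have ev: "\<forall>\<^sub>F y in at x. invertible (F y)"
    by (simp add: eventually_at_filter eventually_mono)
  have F_lim: "((\<lambda>y. F y $ i $ k) \<longlongrightarrow> F x $ i $ k) (at x)" for i k
    using cont unfolding isCont_def by (intro tendsto_intros)
  have "((\<lambda>y. matrix_inv (F y) $ k $ c) \<longlongrightarrow> matrix_inv (F x) $ k $ c) (at x)" for k c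
  proof -
    have "((\<lambda>y. det (\<chi> i j. if j = k then axis c 1 $ i else F y $ i $ j) / det (F y))
        \<longlongrightarrow> matrix_inv (F x) $ k $ c) (at x)"
      unfolding matrix_inv_nth[OF inv] using inv
      by (intro tendsto_divide tendsto_det) (auto simp: F_lim invertible_det_nz)
    moreover have "\<forall>\<^sub>F y in at x. det (\<chi> i j. if j = k then axis c 1 $ i else F y $ i $ j) / det (F y)
        = matrix_inv (F y) $ k $ c"
      using ev by eventually_elim (simp add: matrix_inv_nth)
    ultimately show ?thesis by (rule Lim_transform_eventually)
  qed
  then have inv_lim: "((\<lambda>y. matrix_inv (F y)) \<longlongrightarrow> matrix_inv (F x)) (at x)"
    by (intro vec_tendstoI)
  have "((\<lambda>y. - (matrix_inv (F y) ** ((1 / (y - x)) *\<^sub>R (F y - F x)) ** matrix_inv (F x)))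
      \<longlongrightarrow> - (matrix_inv (F x) ** F' ** matrix_inv (F x))) (at x)"
    using F unfolding has_vector_derivative_iff_quotient
    by (intro tendsto_minus bounded_bilinear.tendsto[OF bounded_bilinear_matrix_mult] inv_lim tendsto_const)
  moreover have "\<forall>\<^sub>F y in at x. - (matrix_inv (F y) ** ((1 / (y - x)) *\<^sub>R (F y - F x)) ** matrix_inv (F x))
      = (1 / (y - x)) *\<^sub>R (matrix_inv (F y) - matrix_inv (F x))"
    using ev
  proof eventually_elim
    case (elim y)
    let ?r = "complex_of_real (1 / (y - x))"
    have "matrix_inv (F y) ** ((1 / (y - x)) *\<^sub>R (F y - F x)) ** matrix_inv (F x)
        = ?r *\<^sub>C (matrix_inv (F y) ** (F y - F x) ** matrix_inv (F x))"
      by (simp only: scaleR_eq_cscale matrix_mul_distribs)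
    also have "matrix_inv (F y) ** (F y - F x) ** matrix_inv (F x)
        = (matrix_inv (F y) ** F y) ** matrix_inv (F x)
          - matrix_inv (F y) ** (F x ** matrix_inv (F x))"
      by (simp only: matrix_mul_distribs matrix_mul_assoc)
    also have "\<dots> = matrix_inv (F x) - matrix_inv (F y)"
      by (simp add: matrix_inv_mult elim inv)
    finally show ?case
      by (simp add: scaleR_eq_cscale vec_eq_iff algebra_simps)
  qed
  ultimately show ?thesis
    unfolding has_vector_derivative_iff_quotient by (rule Lim_transform_eventually)
qed

lemma cscale_minus_one: "(- 1) *\<^sub>C M = - M"
  by (simp add: vec_eq_iff)

lemma cscale_zero: "0 *\<^sub>C M = 0"
  by (simp add: vec_eq_iff)

section \<open>Matrices graded by a signature\<close>

text \<open>
  The cases of \<open>J_cases\<close> are \<open>p = 0\<close> and \<open>p = 1\<close> in \<open>J = j^p\<close>, \<open>K = j^(p+1)\<close>, \<open>\<epsilon> = (-1)^p\<close>. The blocks enter only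
  through the self-adjoint involution \<open>j\<close>: block diagonal matrices are those that commute with it, and
  off-diagonal matrices are those that anticommute with it.
\<close>

locale signature =
  fixes j J K :: "complex^'m^'m" and \<epsilon> :: complex
  assumes j_square: "j ** j = mat 1"
    and ctrans_j: "ctrans j = j"
    and J_cases: "J = mat 1 \<and> K = j \<and> \<epsilon> = 1 \<or> J = j \<and> K = mat 1 \<and> \<epsilon> = - 1"
begin

lemma sig_prod:
  "j ** j = mat 1" "J ** J = mat 1" "K ** K = mat 1"
  "j ** J = K" "J ** j = K" "j ** K = J" "K ** j = J" "J ** K = j" "K ** J = j"
  using J_cases j_square by auto

lemmas sig_prod' = sig_prod sig_prod[THEN mult_eq_extend]

lemma sig_adj: "ctrans j = j" "ctrans J = J" "ctrans K = K" "cnj \<epsilon> = \<epsilon>" "\<epsilon> * \<epsilon> = 1"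
  using J_cases ctrans_j by auto

lemma off_diag_commute:
  assumes "V ** j = - (j ** V)"
  shows "V ** J = \<epsilon> *\<^sub>C (J ** V)" "V ** K = (- \<epsilon>) *\<^sub>C (K ** V)"
  using J_cases assms by (auto simp: cscale_collect cscale_minus_one)

lemma diag_commute:
  assumes "R ** j = j ** R"
  shows "R ** J = J ** R" "R ** K = K ** R"
  using J_cases assms by auto

end

text \<open>
  These rules write a matrix expression as a linear combination of products associated to the right.
  Below, most identities are proved by comparing such normal forms; the coefficients of equal
  products are then compared entrywise.
\<close>

lemmas mat_expand = matrix_mul_distribs matrix_mul_assoc[symmetric] cscale_collect
  matrix_mul_lid matrix_mul_rid

section \<open>The Darboux transformation at a point\<close>

text \<open>
  The values at one point \<open>(x, t)\<close>; \<open>Vd\<close> stands for \<open>V\<^sub>t\<close>, and \<open>Px\<close>, \<open>Pt\<close>, \<open>Sx\<close>, \<open>St\<close> for the right-hand sides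
  of the systems for \<open>\<Pi>\<close> and \<open>S\<close>. Fixing the point separates the noncommutative algebra from the
  calculus.
\<close>

locale darboux_coefficients = signature j J K \<epsilon> for j J K :: "complex^'m^'m" and \<epsilon> +
  fixes A :: "complex^'n^'n" and P :: "complex^'m^'n" and V R Vd :: "complex^'m^'m"
  assumes A_inv: "invertible A"
    and V_adj: "ctrans V = V" and R_adj: "ctrans R = R" and Vd_adj: "ctrans Vd = Vd"
    and V_off: "V ** j = - (j ** V)" and R_diag: "R ** j = j ** R"
    and Vd_off: "Vd ** j = - (j ** Vd)"
begin

definition Q where "Q = \<i> *\<^sub>C (j ** R) - J ** Vd"
text \<open>The self-adjoint core of \<open>Q\<close>, see \<open>Q_eq_M\<close>: it is the weight in the \<open>t\<close>-equation for \<open>S\<close>.\<close>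

definition M where "M = J ** R + (- \<epsilon> * \<i>) *\<^sub>C (j ** Vd)"
definition Px where "Px = A ** P ** ((- \<i> / 4) *\<^sub>C j) + P ** ((\<i> / 2) *\<^sub>C (K ** V))"
definition Pt where "Pt = matrix_inv A ** P ** Q"
definition Sx where "Sx = (1 / 4) *\<^sub>C (P ** J ** ctrans P)"
definition St where "St = matrix_inv A ** P ** M ** ctrans P ** matrix_inv (ctrans A)"

lemmas Vd_commute = Vd_off off_diag_commute[OF Vd_off]
lemmas R_commute = R_diag diag_commute[OF R_diag]

lemma A_cancel:
  "A ** matrix_inv A = mat 1" "matrix_inv A ** A = mat 1"
  "ctrans (matrix_inv A) ** ctrans A = mat 1" "ctrans A ** ctrans (matrix_inv A) = mat 1"
  by (auto simp: matrix_inv_mult A_inv intro!: ctrans_mult_eq_1)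

lemma M_adj: "ctrans M = M"
  by (simp add: M_def mat_expand R_adj Vd_adj sig_adj R_commute Vd_commute)

lemma Q_eq_M: "Q = \<i> *\<^sub>C (M ** K)"
  by (simp add: Q_def M_def mat_expand sig_prod' R_commute Vd_commute
      R_commute[THEN mult_eq_extend] Vd_commute[THEN mult_eq_extend])
     (simp add: vec_eq_iff algebra_simps sig_adj)

lemma Sx_adj: "ctrans Sx = Sx" and St_adj: "ctrans St = St"
  by (simp_all add: Sx_def St_def M_adj sig_adj matrix_inv_ctrans A_inv matrix_mul_assoc)

text \<open>
  These two identities say that \<open>A S - S A\<^sup>*\<close> and \<open>\<i> \<Pi> K \<Pi>\<^sup>*\<close> have the same derivatives. In the first one the
  terms with \<open>V\<close> cancel because \<open>K V K\<close> occurs with both signs; in the second one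
  \<open>\<i> Q K = - M\<close> and \<open>M\<^sup>* = M\<close>.
\<close>

lemma lyapunov_x:
  "A ** Sx - Sx ** ctrans A = \<i> *\<^sub>C (Px ** K ** ctrans P + P ** K ** ctrans Px)"
  by (simp add: Sx_def Px_def mat_expand sig_prod' sig_adj V_adj)
     (simp add: vec_eq_iff algebra_simps)

lemma lyapunov_t:
  "A ** St - St ** ctrans A = \<i> *\<^sub>C (Pt ** K ** ctrans P + P ** K ** ctrans Pt)"
  by (simp add: St_def Pt_def Q_eq_M mat_expand sig_prod' sig_adj M_adj A_cancel matrix_inv_ctrans
      A_inv A_cancel[THEN mult_eq_extend])
     (simp add: vec_eq_iff algebra_simps)

end

locale darboux_point = darboux_coefficients j J K \<epsilon> A P V R Vd
  for j J K :: "complex^'m^'m" and \<epsilon> and A :: "complex^'n^'n" and P V R Vd +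
  fixes S :: "complex^'n^'n"
  assumes S_inv: "invertible S" and S_adj: "ctrans S = S"
    and lyapunov: "A ** S - S ** ctrans A = \<i> *\<^sub>C (P ** K ** ctrans P)"
begin

abbreviation Si where "Si \<equiv> matrix_inv S"
abbreviation Ai where "Ai \<equiv> matrix_inv A"

text \<open>
  A prime marks the transformed objects. The factor \<open>w0\<close> is the Darboux matrix at \<open>\<lambda> = 0\<close>, and its
  inverse is given by an explicit formula.
\<close>

definition X where "X = ctrans P ** Si ** P"
definition B where "B = K ** ctrans P ** Si"
definition V' where "V' = V + (\<i> / 2) *\<^sub>C (j ** X - X ** j)"
definition w where "w l = mat 1 - \<i> *\<^sub>C (B ** matrix_inv (A - mat l) ** P)"
definition w0 where "w0 = mat 1 - \<i> *\<^sub>C (B ** Ai ** P)"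
definition w0_inv where "w0_inv = mat 1 + \<i> *\<^sub>C (K ** ctrans P ** ctrans Ai ** Si ** P)"
definition Q' where "Q' = w0 ** Q ** w0_inv"

lemma S_cancel: "S ** Si = mat 1" "Si ** S = mat 1"
  by (auto simp: matrix_inv_mult S_inv)

lemma Si_adj: "ctrans Si = Si"
  using matrix_inv_ctrans[OF S_inv] S_adj by simp

lemma X_adj: "ctrans X = X"
  by (simp add: X_def Si_adj matrix_mul_assoc)

lemma V'_adj: "ctrans V' = V'"
  by (simp add: V'_def V_adj X_adj sig_adj) (simp add: vec_eq_iff algebra_simps)

lemma V'_off: "V' ** j = - (j ** V')"
  by (simp add: V'_def V_off mat_expand sig_prod')

text \<open>
  The Lyapunov identity multiplied by the inverse of \<open>S\<close> from both sides, and then also by the inverses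
  of \<open>A\<close> and \<open>A\<^sup>*\<close>.
\<close>

lemma adjoint_A_Si: "ctrans A ** Si = Si ** A - \<i> *\<^sub>C (Si ** P ** K ** ctrans P ** Si)"
proof -
  have "Si ** (A ** S - S ** ctrans A) ** Si = Si ** (\<i> *\<^sub>C (P ** K ** ctrans P)) ** Si"
    by (simp only: lyapunov)
  then have "Si ** A - ctrans A ** Si = \<i> *\<^sub>C (Si ** P ** K ** ctrans P ** Si)"
    by (simp add: mat_expand S_cancel S_cancel[THEN mult_eq_extend])
  then show ?thesis by (simp add: algebra_simps)
qed

lemma adjoint_Ai_Si:
  "ctrans Ai ** Si = Si ** Ai + \<i> *\<^sub>C (Si ** Ai ** P ** K ** ctrans P ** ctrans Ai ** Si)"
proof -
  have "Si ** Ai ** (A ** S - S ** ctrans A) ** ctrans Ai ** Si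
      = Si ** Ai ** (\<i> *\<^sub>C (P ** K ** ctrans P)) ** ctrans Ai ** Si"
    by (simp only: lyapunov)
  then have "ctrans Ai ** Si - Si ** Ai
      = \<i> *\<^sub>C (Si ** Ai ** P ** K ** ctrans P ** ctrans Ai ** Si)"
    by (simp add: mat_expand S_cancel A_cancel S_cancel[THEN mult_eq_extend]
        A_cancel[THEN mult_eq_extend])
  then show ?thesis by (simp add: algebra_simps)
qed

text \<open>
  The key step for the inverse of \<open>w0\<close>: it removes the adjoint of \<open>A\<close> from \<open>K \<Pi>\<^sup>* (A\<^sup>*)\<^sup>-\<^sup>1 S\<^sup>-\<^sup>1\<close>.
\<close>

lemma w0_Z: "w0 ** (K ** ctrans P ** ctrans Ai ** Si) = B ** Ai"
proof -
  have "w0 ** (K ** ctrans P ** ctrans Ai ** Si)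
      = K ** ctrans P ** (ctrans Ai ** Si)
        - \<i> *\<^sub>C (B ** Ai ** P ** K ** ctrans P ** ctrans Ai ** Si)"
    by (simp add: w0_def mat_expand)
  also have "\<dots> = B ** Ai"
    unfolding adjoint_Ai_Si by (simp add: B_def mat_expand)
  finally show ?thesis .
qed

lemma w0_right_inverse: "w0 ** w0_inv = mat 1"
proof -
  have "w0 ** w0_inv = w0 + \<i> *\<^sub>C (w0 ** (K ** ctrans P ** ctrans Ai ** Si) ** P)"
    by (simp add: w0_inv_def mat_expand)
  then show ?thesis
    by (simp only: w0_Z) (simp add: w0_def)
qed

lemma w0_left_inverse: "w0_inv ** w0 = mat 1"
  using w0_right_inverse matrix_left_right_inverse by blast

lemma matrix_inv_w0: "matrix_inv w0 = w0_inv"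
  by (rule matrix_inv_unique[OF w0_right_inverse])

lemma invertible_w0: "invertible w0"
  using w0_right_inverse w0_left_inverse unfolding invertible_def by blast

lemma w0_inv_B: "w0_inv ** B ** Ai = K ** ctrans P ** ctrans Ai ** Si"
  using arg_cong[OF w0_Z, of "(**) w0_inv"]
  by (simp add: matrix_mul_assoc w0_left_inverse)

lemma Q'_w0: "Q' ** w0 = w0 ** Q"
  by (simp add: Q'_def mat_expand w0_left_inverse)

text \<open>
  The left-hand sides of \<open>B_x\<close> and \<open>B_t\<close> are the derivatives of \<open>B\<close> in \<open>x\<close> and \<open>t\<close> when \<open>\<Pi>\<close> and \<open>S\<close> solve
  their systems. In the \<open>x\<close>-direction \<open>\<Pi>\<^sup>* A\<^sup>* S\<^sup>-\<^sup>1\<close> is rewritten by \<open>adjoint_A_Si\<close>, and the quadratic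
  term that this produces combines with the derivative of \<open>S\<close> into the commutator \<open>j X - X j\<close>, which is
  exactly what changes \<open>V\<close> into \<open>V'\<close>.
\<close>

lemma B_x:
  "K ** (ctrans Px ** Si - ctrans P ** (Si ** Sx ** Si))
    = (\<i> / 4) *\<^sub>C (j ** B ** A) - (\<i> / 2) *\<^sub>C (K ** V' ** B)"
  by (simp add: Px_def Sx_def B_def V'_def X_def mat_expand sig_prod' sig_adj V_adj adjoint_A_Si)

text \<open>
  The terms from \<open>\<Pi>\<close> and from \<open>S\<close> together give the factor \<open>w0\<close> on the left, and \<open>w0_inv_B\<close> extracts the
  inverse of \<open>w0\<close> on the right.
\<close>

lemma B_t:
  "K ** (ctrans Pt ** Si - ctrans P ** (Si ** St ** Si)) = - (Q' ** B ** Ai)"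
proof -
  have "K ** (ctrans Pt ** Si - ctrans P ** (Si ** St ** Si))
      = (- \<i>) *\<^sub>C (w0 ** M ** ctrans P ** ctrans Ai ** Si)"
    by (simp add: Pt_def St_def Q_eq_M B_def w0_def mat_expand sig_prod' sig_adj M_adj
        matrix_inv_ctrans A_inv)
  also have "\<dots> = - (w0 ** Q ** (K ** ctrans P ** ctrans Ai ** Si))"
    by (simp add: Q_eq_M mat_expand sig_prod')
  also have "\<dots> = - (Q' ** B ** Ai)"
    by (simp add: w0_inv_B[symmetric] Q'_def matrix_mul_assoc)
  finally show ?thesis .
qed

lemma resolvent_A:
  assumes "invertible (A - mat l)"
  shows "A ** matrix_inv (A - mat l) = mat 1 + l *\<^sub>C matrix_inv (A - mat l)"
    and "matrix_inv (A - mat l) ** A = mat 1 + l *\<^sub>C matrix_inv (A - mat l)"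
proof -
  have l: "mat l = l *\<^sub>C (mat 1 :: complex^'n^'n)" by (simp add: vec_eq_iff mat_def)
  show "A ** matrix_inv (A - mat l) = mat 1 + l *\<^sub>C matrix_inv (A - mat l)"
    using matrix_inv_mult(1)[OF assms] by (simp add: l matrix_mul_distribs algebra_simps)
  show "matrix_inv (A - mat l) ** A = mat 1 + l *\<^sub>C matrix_inv (A - mat l)"
    using matrix_inv_mult(2)[OF assms] by (simp add: l matrix_mul_distribs algebra_simps)
qed

lemma resolvent_Ai:
  assumes "invertible (A - mat l)" "l \<noteq> 0"
  shows "Ai ** matrix_inv (A - mat l) = (1 / l) *\<^sub>C (matrix_inv (A - mat l) - Ai)"
    and "matrix_inv (A - mat l) ** Ai = (1 / l) *\<^sub>C (matrix_inv (A - mat l) - Ai)"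
proof -
  let ?N = "matrix_inv (A - mat l)"
  have "?N = Ai ** (A ** ?N)" by (simp add: matrix_mul_assoc A_cancel)
  also have "\<dots> = Ai + l *\<^sub>C (Ai ** ?N)"
    by (simp add: resolvent_A assms matrix_mul_distribs)
  finally have "?N - Ai = l *\<^sub>C (Ai ** ?N)" by (simp add: algebra_simps)
  then show "Ai ** ?N = (1 / l) *\<^sub>C (?N - Ai)" using assms(2) by (simp add: cscale_collect)
  have "?N = (?N ** A) ** Ai" by (simp add: matrix_mul_assoc[symmetric] A_cancel)
  also have "\<dots> = Ai + l *\<^sub>C (?N ** Ai)"
    by (simp add: resolvent_A assms matrix_mul_distribs)
  finally have "?N - Ai = l *\<^sub>C (?N ** Ai)" by (simp add: algebra_simps)
  then show "?N ** Ai = (1 / l) *\<^sub>C (?N - Ai)" using assms(2) by (simp add: cscale_collect)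
qed

lemma w_0: "w 0 = w0"
  by (simp add: w_def w0_def)

text \<open>
  Products of \<open>A\<close> with its resolvent are reduced by \<open>resolvent_A\<close>; what is left besides \<open>G' w - w G\<close> cancels by
  the definition of \<open>V'\<close>.
\<close>

lemma w_x:
  assumes "invertible (A - mat l)"
  shows "- (\<i> *\<^sub>C (((\<i> / 4) *\<^sub>C (j ** B ** A) - (\<i> / 2) *\<^sub>C (K ** V' ** B))
              ** matrix_inv (A - mat l) ** P + B ** matrix_inv (A - mat l) ** Px))
    = ((\<i> / 4 * l) *\<^sub>C j - (\<i> / 2) *\<^sub>C (K ** V')) ** w l
      - w l ** ((\<i> / 4 * l) *\<^sub>C j - (\<i> / 2) *\<^sub>C (K ** V))"
  by (simp add: w_def B_def V'_def X_def Px_def mat_expand resolvent_A[OF assms]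
        resolvent_A[OF assms, THEN mult_eq_extend] sig_prod')
     (simp add: vec_eq_iff algebra_simps)

text \<open>
  By \<open>resolvent_Ai\<close> the left-hand side only involves \<open>w l - w0\<close>, and the contribution of \<open>w0\<close> vanishes because
  \<open>Q'\<close> and \<open>Q\<close> are intertwined by \<open>w0\<close>.
\<close>

lemma w_t:
  assumes "invertible (A - mat l)" "l \<noteq> 0"
  shows "- (\<i> *\<^sub>C (- (Q' ** B ** Ai) ** matrix_inv (A - mat l) ** P
            + B ** matrix_inv (A - mat l) ** Pt))
    = ((- 1 / l) *\<^sub>C Q') ** w l - w l ** ((- 1 / l) *\<^sub>C Q)"
proof -
  let ?N = "matrix_inv (A - mat l)"
  have "- (\<i> *\<^sub>C (- (Q' ** B ** Ai) ** ?N ** P + B ** ?N ** Pt))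
      = (1 / l) *\<^sub>C (- (Q' ** (w l - w0)) + (w l - w0) ** Q)"
    by (simp add: w_def w0_def Pt_def mat_expand resolvent_Ai[OF assms]
        resolvent_Ai[OF assms, THEN mult_eq_extend])
  also have "\<dots> = ((- 1 / l) *\<^sub>C Q') ** w l - w l ** ((- 1 / l) *\<^sub>C Q)"
    by (simp add: mat_expand Q'_w0) (simp add: vec_eq_iff algebra_simps)
  finally show ?thesis .
qed

text \<open>
  The diagonal and the off-diagonal part of \<open>Q'\<close> in the decomposition \<open>Q' = \<i> j R' - J V'\<^sub>t\<close>. That \<open>Vd'\<close> is the
  derivative of \<open>V'\<close> in \<open>t\<close> is shown by \<open>V'_t\<close>.
\<close>

definition R' where "R' = (1 / (2 * \<i>)) *\<^sub>C (Q' ** j + j ** Q')"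
definition Vd' where "Vd' = (- 1 / 2) *\<^sub>C (J ** (Q' - j ** Q' ** j))"

lemma Q'_split: "Q' = \<i> *\<^sub>C (j ** R') - J ** Vd'"
  by (simp add: R'_def Vd'_def mat_expand sig_prod') (simp add: vec_eq_iff algebra_simps)

text \<open>
  \<open>w0\<close> is unitary with respect to the indefinite form given by \<open>K\<close>. Hence \<open>Q'\<close> has the same shape as \<open>Q\<close>,
  with the self-adjoint core \<open>w0 M w0\<^sup>*\<close> in place of \<open>M\<close>, and this makes its two parts self-adjoint.
\<close>

lemma w0_inv_eq_adjoint: "w0_inv = K ** ctrans w0 ** K"
  by (simp add: w0_inv_def w0_def B_def mat_expand sig_prod' sig_adj Si_adj)

lemma Q'_eq: "Q' = \<i> *\<^sub>C (w0 ** M ** ctrans w0 ** K)"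
  by (simp add: Q'_def w0_inv_eq_adjoint Q_eq_M mat_expand sig_prod')

lemma R'_adj: "ctrans R' = R'"
proof -
  let ?N = "w0 ** M ** ctrans w0"
  have R': "R' = (1 / 2) *\<^sub>C (?N ** J + j ** ?N ** K)"
    by (simp add: R'_def Q'_eq mat_expand sig_prod')
  have "K ** ?N ** j + J ** ?N = ?N ** J + j ** ?N ** K"
    using J_cases by (auto simp: add.commute)
  then show ?thesis
    by (simp add: R' sig_adj M_adj matrix_mul_assoc add.commute)
qed

lemma Vd'_adj: "ctrans Vd' = Vd'"
  by (simp add: Vd'_def Q'_eq mat_expand sig_prod' sig_adj M_adj)
     (simp add: vec_eq_iff algebra_simps)

lemma R'_diag: "R' ** j = j ** R'"
  by (simp add: R'_def mat_expand sig_prod' add.commute)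

lemma Vd'_off: "Vd' ** j = - (j ** Vd')"
proof -
  have "J ** (Q' - j ** Q' ** j) ** j = - (j ** (J ** (Q' - j ** Q' ** j)))"
    using J_cases by (auto simp: mat_expand j_square j_square[THEN mult_eq_extend])
  then show ?thesis
    by (simp add: Vd'_def mat_expand) (simp add: vec_eq_iff algebra_simps)
qed

text \<open>
  \<open>B_t\<close> multiplied by \<open>\<Pi>\<close> on the right, with the derivative of this last factor added: as
  \<open>B A\<^sup>-\<^sup>1 \<Pi> = \<i> (w0 - I)\<close>, the relation \<open>Q' w0 = w0 Q\<close> cancels everything but \<open>Q' - Q\<close>.
\<close>

lemma X_t:
  "ctrans Pt ** Si ** P - ctrans P ** (Si ** St ** Si) ** P + ctrans P ** Si ** Pt
    = \<i> *\<^sub>C (K ** (Q' - Q))" (is "?X = _")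
proof -
  have BP: "B ** Ai ** P = \<i> *\<^sub>C (w0 - mat 1)"
    by (simp add: w0_def mat_expand)
  have "K ** ?X = K ** (ctrans Pt ** Si - ctrans P ** (Si ** St ** Si)) ** P + B ** Pt"
    by (simp add: B_def mat_expand)
  also have "\<dots> = - (Q' ** (B ** Ai ** P)) + (B ** Ai ** P) ** Q"
    unfolding B_t by (simp add: Pt_def mat_expand)
  also have "\<dots> = \<i> *\<^sub>C (Q' - Q)"
    unfolding BP by (simp add: mat_expand Q'_w0)
  finally have "K ** (K ** ?X) = K ** (\<i> *\<^sub>C (Q' - Q))"
    by simp
  then show ?thesis
    by (simp only: sig_prod' matrix_mul_lid) (simp add: mat_expand)
qed

text \<open>
  By \<open>X_t\<close> the left-hand side is the derivative of \<open>V'\<close>. The commutator with \<open>j\<close> selects the off-diagonal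
  parts, and that of \<open>Q\<close> is \<open>- J Vd\<close>, which cancels \<open>Vd\<close>.
\<close>

lemma V'_t: "Vd + (\<i> / 2) *\<^sub>C (j ** (\<i> *\<^sub>C (K ** (Q' - Q))) - \<i> *\<^sub>C (K ** (Q' - Q)) ** j) = Vd'"
  by (simp add: Vd'_def Q_def mat_expand sig_prod' R_commute[THEN mult_eq_extend] R_commute Vd_commute
      Vd_commute[THEN mult_eq_extend])
     (simp add: vec_eq_iff algebra_simps)

end

section \<open>Zero curvature and derivatives along coordinate lines\<close>

context signature
begin

text \<open>
  The left-hand side is \<open>Q\<^sub>x\<close> when the dispersionless equation holds, the right-hand side is the
  commutator of \<open>- (\<i>/2) K V\<close> with \<open>Q\<close>.
\<close>

lemma zero_curvature:
  assumes V: "V ** j = - (j ** V)" and Vd: "Vd ** j = - (j ** Vd)" and R: "R ** j = j ** R"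
    and Q: "Q = \<i> *\<^sub>C (j ** R) - J ** Vd"
  shows "\<i> *\<^sub>C (j ** ((\<epsilon> / 2) *\<^sub>C (V ** Vd + Vd ** V))) - J ** ((1 / 2) *\<^sub>C (V ** R + R ** V))
    = (- \<i> / 2) *\<^sub>C (K ** V ** Q - Q ** K ** V)"
  using off_diag_commute[OF V] off_diag_commute[OF Vd] diag_commute[OF R] sig_adj(5)
  by (simp add: Q mat_expand sig_prod' V Vd R V[THEN mult_eq_extend] Vd[THEN mult_eq_extend]
     R[THEN mult_eq_extend] off_diag_commute[OF V, THEN mult_eq_extend]
     off_diag_commute[OF Vd, THEN mult_eq_extend] diag_commute[OF R, THEN mult_eq_extend])

text \<open>
  Conversely, the two projections that recover \<open>R\<close> and \<open>V\<^sub>t\<close> from \<open>Q\<close> recover the two equations from the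
  zero curvature form of \<open>Q\<^sub>x\<close>.
\<close>

lemma zero_curvature_blocks:
  assumes V: "V ** j = - (j ** V)" and Vd: "Vd ** j = - (j ** Vd)" and R: "R ** j = j ** R"
    and Q: "Q = \<i> *\<^sub>C (j ** ((\<epsilon> / 2) *\<^sub>C (V ** Vd + Vd ** V))) - J ** ((1 / 2) *\<^sub>C (V ** R + R ** V))"
  shows "(1 / (2 * \<i>)) *\<^sub>C (Q ** j + j ** Q) = (\<epsilon> / 2) *\<^sub>C (V ** Vd + Vd ** V)"
    and "(- 1 / 2) *\<^sub>C (J ** (Q - j ** Q ** j)) = (1 / 2) *\<^sub>C (V ** R + R ** V)"
  by (simp_all only: Q mat_expand sig_prod' V Vd R V[THEN mult_eq_extend] Vd[THEN mult_eq_extend]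
     R[THEN mult_eq_extend])
     (simp_all add: vec_eq_iff algebra_simps)

lemma has_vector_derivative_B:
  fixes Sf :: "real \<Rightarrow> complex^'n^'n"
  assumes "(Pf has_vector_derivative P') (at s)" "(Sf has_vector_derivative S') (at s)"
    "invertible (Sf s)"
  shows "((\<lambda>y. K ** ctrans (Pf y) ** matrix_inv (Sf y)) has_vector_derivative
    K ** (ctrans P' ** matrix_inv (Sf s)
      - ctrans (Pf s) ** (matrix_inv (Sf s) ** S' ** matrix_inv (Sf s)))) (at s)"
  by (rule has_vector_derivative_eq_rhs[OF has_vector_derivative_matrix_mult[OF
        has_vector_derivative_matrix_mult[OF has_vector_derivative_const
        has_vector_derivative_ctrans[OF assms(1)]] has_vector_derivative_matrix_inv[OF assms(2,3)]]])
     (simp add: mat_expand)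

lemma has_vector_derivative_w:
  assumes B: "(Bf has_vector_derivative B') (at s)" and P: "(Pf has_vector_derivative P') (at s)"
  shows "((\<lambda>y. mat 1 - \<i> *\<^sub>C (Bf y ** N ** Pf y)) has_vector_derivative
    - (\<i> *\<^sub>C (B' ** N ** Pf s + Bf s ** N ** P'))) (at s)"
  by (rule has_vector_derivative_eq_rhs[OF has_vector_derivative_diff[OF has_vector_derivative_const
        has_vector_derivative_cscale[OF has_vector_derivative_matrix_mult[OF
        has_vector_derivative_matrix_mult[OF B has_vector_derivative_const] P]]]])
     (simp add: mat_expand algebra_simps)

end

context darboux_point
begin

lemma has_vector_derivative_w_x:
  assumes P: "(Pf has_vector_derivative Px) (at s)" "Pf s = P"
    and S: "(Sf has_vector_derivative Sx) (at s)" "Sf s = S"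
    and l: "invertible (A - mat l)"
  shows "((\<lambda>y. mat 1 - \<i> *\<^sub>C (K ** ctrans (Pf y) ** matrix_inv (Sf y)
      ** matrix_inv (A - mat l) ** Pf y)) has_vector_derivative
      ((\<i> / 4 * l) *\<^sub>C j - (\<i> / 2) *\<^sub>C (K ** V')) ** w l
      - w l ** ((\<i> / 4 * l) *\<^sub>C j - (\<i> / 2) *\<^sub>C (K ** V))) (at s)"
  using has_vector_derivative_w[OF has_vector_derivative_B[OF P(1) S(1)] P(1),
      of "matrix_inv (A - mat l)"] S_inv
  by (simp only: P S B_x B_def[symmetric] w_x[OF l])

lemma has_vector_derivative_w_t:
  assumes P: "(Pf has_vector_derivative Pt) (at s)" "Pf s = P"
    and S: "(Sf has_vector_derivative St) (at s)" "Sf s = S"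
    and l: "invertible (A - mat l)" "l \<noteq> 0"
  shows "((\<lambda>y. mat 1 - \<i> *\<^sub>C (K ** ctrans (Pf y) ** matrix_inv (Sf y)
      ** matrix_inv (A - mat l) ** Pf y)) has_vector_derivative
      ((- 1 / l) *\<^sub>C Q') ** w l - w l ** ((- 1 / l) *\<^sub>C Q)) (at s)"
  using has_vector_derivative_w[OF has_vector_derivative_B[OF P(1) S(1)] P(1),
      of "matrix_inv (A - mat l)"] S_inv
  by (simp only: P S B_t B_def[symmetric] w_t[OF l])

lemma has_vector_derivative_V'_t:
  assumes P: "(Pf has_vector_derivative Pt) (at s)" "Pf s = P"
    and S: "(Sf has_vector_derivative St) (at s)" "Sf s = S"
    and V: "(Vf has_vector_derivative Vd) (at s)"
  shows "((\<lambda>y. Vf y + (\<i> / 2) *\<^sub>C (j ** (ctrans (Pf y) ** matrix_inv (Sf y) ** Pf y)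
      - ctrans (Pf y) ** matrix_inv (Sf y) ** Pf y ** j)) has_vector_derivative Vd') (at s)"
proof -
  have "((\<lambda>y. ctrans (Pf y) ** matrix_inv (Sf y) ** Pf y) has_vector_derivative
      \<i> *\<^sub>C (K ** (Q' - Q))) (at s)"
    by (rule has_vector_derivative_eq_rhs[OF has_vector_derivative_matrix_mult[OF
        has_vector_derivative_matrix_mult[OF has_vector_derivative_ctrans[OF P(1)]
        has_vector_derivative_matrix_inv[OF S(1)]] P(1)]])
      (simp_all only: S P S_inv X_t[symmetric], simp add: mat_expand algebra_simps)
  note X' = this
  show ?thesis
    unfolding V'_t[symmetric]
    by (rule has_vector_derivative_eq_rhs[OF has_vector_derivative_add[OF V
        has_vector_derivative_cscale[OF has_vector_derivative_diff[OF
        has_vector_derivative_matrix_mult[OF has_vector_derivative_const X']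
        has_vector_derivative_matrix_mult[OF X' has_vector_derivative_const]]]]])
      simp
qed

text \<open>
  Conjugation by a solution of \<open>w\<^sub>x = G' w - w G\<close> transports \<open>Q\<^sub>x = [G, Q]\<close> to \<open>Q'\<^sub>x = [G', Q']\<close>.
\<close>

lemma has_vector_derivative_Q'_x:
  assumes w: "(Wf has_vector_derivative
      (- (\<i> / 2) *\<^sub>C (K ** V')) ** w0 - w0 ** (- (\<i> / 2) *\<^sub>C (K ** V))) (at s)" "Wf s = w0"
    and Q: "(Qf has_vector_derivative (- \<i> / 2) *\<^sub>C (K ** V ** Q - Q ** K ** V)) (at s)" "Qf s = Q"
  shows "((\<lambda>y. Wf y ** Qf y ** matrix_inv (Wf y)) has_vector_derivative
     (- \<i> / 2) *\<^sub>C (K ** V' ** Q' - Q' ** K ** V')) (at s)"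
proof (rule has_vector_derivative_eq_rhs[OF has_vector_derivative_matrix_mult[OF
        has_vector_derivative_matrix_mult[OF w(1) Q(1)] has_vector_derivative_matrix_inv[OF w(1)]]])
  show "Wf s ** Qf s ** - (matrix_inv (Wf s) **
        ((- (\<i> / 2) *\<^sub>C (K ** V')) ** w0 - w0 ** (- (\<i> / 2) *\<^sub>C (K ** V))) ** matrix_inv (Wf s))
      + (Wf s ** ((- \<i> / 2) *\<^sub>C (K ** V ** Q - Q ** K ** V))
         + ((- (\<i> / 2) *\<^sub>C (K ** V')) ** w0 - w0 ** (- (\<i> / 2) *\<^sub>C (K ** V))) ** Qf s)
          ** matrix_inv (Wf s)
      = (- \<i> / 2) *\<^sub>C (K ** V' ** Q' - Q' ** K ** V')"
    by (simp add: w Q matrix_inv_w0 Q'_def mat_expand w0_right_inverse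
      w0_left_inverse w0_right_inverse[THEN mult_eq_extend] w0_left_inverse[THEN mult_eq_extend])
      (simp add: vec_eq_iff algebra_simps)
qed (simp add: w invertible_w0)

end

section \<open>Block matrices\<close>

lemma sum_sum_type:
  fixes f :: "'a::finite + 'b::finite \<Rightarrow> complex"
  shows "(\<Sum>x\<in>UNIV. f x) = (\<Sum>a\<in>UNIV. f (Inl a)) + (\<Sum>b\<in>UNIV. f (Inr b))"
  by (simp add: UNIV_Plus_UNIV[symmetric] sum.Plus del: UNIV_Plus_UNIV)

lemma block_mat_nth [simp]:
  "block_mat a b c d $ Inl i $ Inl k = a $ i $ k"
  "block_mat a b c d $ Inl i $ Inr k' = b $ i $ k'"
  "block_mat a b c d $ Inr i' $ Inl k = c $ i' $ k"
  "block_mat a b c d $ Inr i' $ Inr k' = d $ i' $ k'"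
  by (simp_all add: block_mat_def)

lemma sum_index_eq_iff:
  fixes M N :: "complex^('a::finite + 'b::finite)^('a + 'b)"
  shows "M = N \<longleftrightarrow>
    (\<forall>i k. M $ Inl i $ Inl k = N $ Inl i $ Inl k) \<and> (\<forall>i k. M $ Inl i $ Inr k = N $ Inl i $ Inr k) \<and>
    (\<forall>i k. M $ Inr i $ Inl k = N $ Inr i $ Inl k) \<and> (\<forall>i k. M $ Inr i $ Inr k = N $ Inr i $ Inr k)"
  unfolding vec_eq_iff by (metis sum.exhaust)

lemma block_mat_eq_iff:
  "block_mat a b c d = block_mat a' b' c' d' \<longleftrightarrow> a = a' \<and> b = b' \<and> c = c' \<and> d = d'"
  unfolding sum_index_eq_iff by (auto simp: vec_eq_iff)

lemma block_mat_exhaust: obtains a b c d where "M = block_mat a b c d"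
proof
  show "M = block_mat (\<chi> i k. M $ Inl i $ Inl k) (\<chi> i k. M $ Inl i $ Inr k)
      (\<chi> i k. M $ Inr i $ Inl k) (\<chi> i k. M $ Inr i $ Inr k)"
    by (simp add: sum_index_eq_iff)
qed

lemma block_mat_simps:
  "block_mat a b c d + block_mat a' b' c' d' = block_mat (a + a') (b + b') (c + c') (d + d')"
  "- block_mat a b c d = block_mat (- a) (- b) (- c) (- d)"
  "z *\<^sub>C block_mat a b c d = block_mat (z *\<^sub>C a) (z *\<^sub>C b) (z *\<^sub>C c) (z *\<^sub>C d)"
  "ctrans (block_mat a b c d) = block_mat (ctrans a) (ctrans c) (ctrans b) (ctrans d)"
  "mat 1 = block_mat (mat 1) 0 0 (mat 1)"
  "block_mat a b c d ** block_mat a' b' c' d'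
    = block_mat (a ** a' + b ** c') (a ** b' + b ** d') (c ** a' + d ** c') (c ** b' + d ** d')"
  by (simp_all add: sum_index_eq_iff mat_def matrix_matrix_mult_def sum_sum_type)

lemma block_mat_blocks:
  "row_I0 ** block_mat a b c d ** ctrans row_I0 = a"
  "row_I0 ** block_mat a b c d ** col_0I = b"
  "ctrans col_0I ** block_mat a b c d ** col_0I = d"
  by (simp_all add: vec_eq_iff row_I0_def col_0I_def matrix_matrix_mult_def sum_sum_type
      if_distrib[of cnj] if_distrib[of "\<lambda>x. x * _"] if_distrib[of "\<lambda>x. _ * x"] cong: if_cong)

lemma jmat_signature: 
  assumes "p \<in> {0, 1}"
  shows "signature jmat (mpow jmat p) (mpow jmat (p + 1)) ((-1) ^ p)"
proof
  show "jmat ** jmat = (mat 1 :: complex^('a::finite + 'b::finite)^('a + 'b))"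
    "ctrans jmat = (jmat :: complex^('a::finite + 'b::finite)^('a + 'b))"
    by (simp_all add: jmat_def block_mat_simps mat_expand block_mat_eq_iff)
  then show "mpow jmat p = (mat 1 :: complex^('a + 'b)^('a + 'b))
      \<and> mpow jmat (p + 1) = (jmat :: complex^('a + 'b)^('a + 'b))
      \<and> (- 1) ^ p = (1 :: complex) \<or>
    mpow jmat p = (jmat :: complex^('a + 'b)^('a + 'b))
      \<and> mpow jmat (p + 1) = (mat 1 :: complex^('a + 'b)^('a + 'b))
      \<and> (- 1) ^ p = (- 1 :: complex)"
    using assms by (auto simp: mpow_def)
qed

lemma off_diag_block_mat: "block_mat 0 b c 0 ** jmat = - (jmat ** block_mat 0 b c 0)"
  and diag_block_mat: "block_mat a 0 0 d ** jmat = jmat ** block_mat a 0 0 d"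
  by (simp_all add: jmat_def block_mat_simps mat_expand block_mat_eq_iff)

lemma off_diag_adjoint_eq:
  assumes "M ** jmat = - (jmat ** M)" "ctrans M = M"
  shows "M = block_mat 0 (row_I0 ** M ** col_0I) (ctrans (row_I0 ** M ** col_0I)) 0"
proof -
  obtain a b c d where M: "M = block_mat a b c d" by (rule block_mat_exhaust)
  have "a = - a" "d = - d" "ctrans b = c"
    using assms unfolding M jmat_def block_mat_simps mat_expand block_mat_eq_iff by auto
  then have "a = 0" "d = 0" "ctrans b = c" by (simp_all add: vec_eq_iff)
  then show ?thesis by (simp add: M block_mat_blocks)
qed

lemma bounded_linear_off_diag: "bounded_linear (\<lambda>v. block_mat 0 v (ctrans v) 0)"
  unfolding linear_conv_bounded_linear[symmetric]
  by (rule linearI) (auto simp: block_mat_simps scaleR_eq_cscale cscale_collect)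

lemma bounded_linear_diag: "bounded_linear (\<lambda>(a, d). block_mat a 0 0 d)"
  unfolding linear_conv_bounded_linear[symmetric]
  by (rule linearI) (auto simp: block_mat_simps scaleR_eq_cscale cscale_collect)

lemma has_vector_derivative_sandwich:
  fixes f :: "real \<Rightarrow> complex^'b^'a" and L :: "complex^'a^'c" and N :: "complex^'d^'b"
  assumes "(f has_vector_derivative f') (at s)"
  shows "((\<lambda>y. L ** f y ** N) has_vector_derivative (L ** f' ** N)) (at s)"
  by (rule has_vector_derivative_eq_rhs[OF has_vector_derivative_matrix_mult[OF
        has_vector_derivative_matrix_mult[OF has_vector_derivative_const assms]
        has_vector_derivative_const]]) (simp add: mat_expand)

section \<open>The dispersionless equation in matrix form\<close>

lemma eventually_rect:
  assumes "(x, t) \<in> rect a1 a2 b1 b2"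
  shows "\<forall>\<^sub>F y in nhds x. (y, t) \<in> rect a1 a2 b1 b2" "\<forall>\<^sub>F s in nhds t. (x, s) \<in> rect a1 a2 b1 b2"
proof -
  have ereal_lim: "(ereal \<longlongrightarrow> ereal z) (nhds z)" for z
    by (intro tendsto_intros filterlim_ident)
  have "\<forall>\<^sub>F y in nhds z. a < ereal y \<and> ereal y < b" if "a < ereal z" "ereal z < b" for a b z
    using order_tendstoD[OF ereal_lim] that by (auto intro: eventually_conj)
  then show "\<forall>\<^sub>F y in nhds x. (y, t) \<in> rect a1 a2 b1 b2" "\<forall>\<^sub>F s in nhds t. (x, s) \<in> rect a1 a2 b1 b2"
    using assms by (auto simp: rect_def)
qed

lemma zero_derivative_on_interval:
  fixes f :: "real \<Rightarrow> 'a::real_normed_vector"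
  assumes "\<And>y. a < ereal y \<Longrightarrow> ereal y < b \<Longrightarrow> (f has_vector_derivative 0) (at y)"
    and "a < ereal x" "ereal x < b" "a < ereal z" "ereal z < b"
  shows "f x = f z"
proof -
  let ?I = "{y. a < ereal y \<and> ereal y < b}"
  have "convex ?I"
    by (auto simp: is_interval_convex_1[symmetric] is_interval_1)
      (metis ereal_less_eq(3) less_le_trans le_less_trans)+
  then obtain c where "\<And>y. y \<in> ?I \<Longrightarrow> f y = c"
    using has_vector_derivative_zero_constant[of ?I f] assms(1)
    by (metis (mono_tags, lifting) has_vector_derivative_at_within mem_Collect_eq)
  then show ?thesis using assms(2-) by auto
qed

text \<open>
  The origin is reached from \<open>(x, t)\<close> through \<open>(x, 0)\<close>, one partial derivative being used on each leg.
\<close>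

lemma constant_on_rect:
  assumes "\<And>x t. (x, t) \<in> rect a1 a2 b1 b2 \<Longrightarrow> has_dx f 0 x t"
    and "\<And>x t. (x, t) \<in> rect a1 a2 b1 b2 \<Longrightarrow> has_dt f 0 x t"
    and "(0, 0) \<in> rect a1 a2 b1 b2" "(x, t) \<in> rect a1 a2 b1 b2"
  shows "f x t = f 0 0"
proof -
  have "f x t = f x 0"
    using assms by (intro zero_derivative_on_interval[of b1 b2 "f x"])
      (auto simp: rect_def has_dt_def zero_ereal_def)
  also have "\<dots> = f 0 0"
    using assms by (intro zero_derivative_on_interval[of a1 a2 "\<lambda>y. f y 0"])
      (auto simp: rect_def has_dx_def zero_ereal_def)
  finally show ?thesis .
qed

lemma has_dt_imp_dt_eq: "has_dt f d x t \<Longrightarrow> dt f x t = d"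
  by (simp add: has_dt_def dt_def vector_derivative_at)

lemma has_vector_derivative_transform_eventually:
  assumes "(f has_vector_derivative d) (at x)" "\<forall>\<^sub>F y in nhds x. f y = g y"
  shows "(g has_vector_derivative d) (at x)"
  using assms has_vector_derivative_cong_ev[of UNIV f g x d] eventually_nhds_x_imp_x[OF assms(2)]
  by simp

text \<open>
  The upper right block of \<open>(V R + R V)/2\<close> is the equation for \<open>v\<^sub>t\<^sub>x\<close>; the lower left block is its adjoint, which
  is where self-adjointness of \<open>r1\<close> and \<open>r2\<close> enters. Openness of \<open>U\<close> along the \<open>x\<close>-line is needed because
  the \<open>x\<close>-derivative of \<open>V\<^sub>t\<close> depends on the values of \<open>V\<^sub>t\<close> at nearby points.
\<close>

lemma dispersionless_matrix_form:
  assumes disp: "dispersionless p U v r1 r2" and xt: "(x, t) \<in> U"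
    and r_adj: "ctrans (r1 x t) = r1 x t" "ctrans (r2 x t) = r2 x t"
    and U: "\<forall>\<^sub>F y in nhds x. (y, t) \<in> U"
  shows "has_dt (Vmat v) (Vmat (dt v) x t) x t"
    and "has_dx (dt (Vmat v))
      ((1/2) *\<^sub>C (Vmat v x t ** Rmat r1 r2 x t + Rmat r1 r2 x t ** Vmat v x t)) x t"
    and "has_dx (Rmat r1 r2)
      (((-1)^p / 2) *\<^sub>C (Vmat v x t ** Vmat (dt v) x t + Vmat (dt v) x t ** Vmat v x t)) x t"
proof -
  have v_t: "has_dt v (dt v y s) y s" if "(y, s) \<in> U" for y s
    using disp that by (auto simp: dispersionless_def has_dt_def dt_def vector_derivative_works)
  have Vmat_t: "has_dt (Vmat v) (Vmat (dt v) y s) y s" if "(y, s) \<in> U" for y s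
    using bounded_linear.has_vector_derivative[OF bounded_linear_off_diag v_t[OF that, unfolded has_dt_def]]
    by (simp add: has_dt_def Vmat_def)
  show "has_dt (Vmat v) (Vmat (dt v) x t) x t" by (rule Vmat_t[OF xt])
  let ?vd = "(1/2) *\<^sub>R (r1 x t ** v x t + v x t ** r2 x t)"
  have "has_dx (dt v) ?vd x t" using disp xt by (auto simp: dispersionless_def)
  then have "((\<lambda>y. Vmat (dt v) y t) has_vector_derivative block_mat 0 ?vd (ctrans ?vd) 0) (at x)"
    using bounded_linear.has_vector_derivative[OF bounded_linear_off_diag]
    by (simp add: has_dx_def Vmat_def)
  moreover have "\<forall>\<^sub>F y in nhds x. Vmat (dt v) y t = dt (Vmat v) y t"
    using U by eventually_elim (simp add: has_dt_imp_dt_eq[OF Vmat_t])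
  ultimately have "has_dx (dt (Vmat v)) (block_mat 0 ?vd (ctrans ?vd) 0) x t"
    unfolding has_dx_def by (rule has_vector_derivative_transform_eventually)
  moreover have "block_mat 0 ?vd (ctrans ?vd) 0
      = (1/2) *\<^sub>C (Vmat v x t ** Rmat r1 r2 x t + Rmat r1 r2 x t ** Vmat v x t)"
    using r_adj by (simp add: Vmat_def Rmat_def block_mat_simps block_mat_eq_iff scaleR_eq_cscale mat_expand add.commute)
  ultimately show "has_dx (dt (Vmat v))
      ((1/2) *\<^sub>C (Vmat v x t ** Rmat r1 r2 x t + Rmat r1 r2 x t ** Vmat v x t)) x t" by simp
  note v = v_t[OF xt, unfolded has_dt_def]
  note v_adj = has_vector_derivative_ctrans[OF v]
  have "has_dt (\<lambda>y s. v y s ** ctrans (v y s))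
      (v x t ** ctrans (dt v x t) + dt v x t ** ctrans (v x t)) x t"
    and "has_dt (\<lambda>y s. ctrans (v y s) ** v y s)
      (ctrans (v x t) ** dt v x t + ctrans (dt v x t) ** v x t) x t"
    unfolding has_dt_def by (rule has_vector_derivative_matrix_mult[OF v v_adj]
      has_vector_derivative_matrix_mult[OF v_adj v])+
  note products = this[THEN has_dt_imp_dt_eq]
  have "has_dx r1 (((-1)^p / 2) *\<^sub>R (v x t ** ctrans (dt v x t) + dt v x t ** ctrans (v x t))) x t"
    "has_dx r2 (((-1)^p / 2) *\<^sub>R (ctrans (v x t) ** dt v x t + ctrans (dt v x t) ** v x t)) x t"
    using disp xt unfolding products[symmetric] by (auto simp: dispersionless_def)
  from bounded_linear.has_vector_derivative[OF bounded_linear_diag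
    has_vector_derivative_Pair[OF this[unfolded has_dx_def]]]
  show "has_dx (Rmat r1 r2) (((-1)^p / 2) *\<^sub>C
      (Vmat v x t ** Vmat (dt v) x t + Vmat (dt v) x t ** Vmat v x t)) x t"
    by (simp add: has_dx_def Rmat_def Vmat_def block_mat_simps scaleR_eq_cscale mat_expand)
qed

text \<open>
  The functions \<open>v\<close>, \<open>r1\<close>, \<open>r2\<close> are tied to \<open>W\<close> and \<open>T\<close> on \<open>U\<close> only and are arbitrary outside. Therefore their
  derivatives are taken from those of the blocks of \<open>W\<close>, \<open>Wd\<close> and \<open>T\<close> by local agreement along the
  coordinate lines.
\<close>

lemma dispersionlessI_matrix_form:
  fixes W Wd T
  assumes U: "\<And>x t. (x, t) \<in> U \<Longrightarrow> (\<forall>\<^sub>F y in nhds x. (y, t) \<in> U) \<and> (\<forall>\<^sub>F s in nhds t. (x, s) \<in> U)"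
    and v: "\<And>x t. (x, t) \<in> U \<Longrightarrow> v x t = row_I0 ** W x t ** col_0I"
    and r: "\<And>x t. (x, t) \<in> U \<Longrightarrow> Rmat r1 r2 x t = T x t"
    and W: "\<And>x t. (x, t) \<in> U \<Longrightarrow> W x t ** jmat = - (jmat ** W x t) \<and> ctrans (W x t) = W x t"
    and Wd: "\<And>x t. (x, t) \<in> U \<Longrightarrow> Wd x t ** jmat = - (jmat ** Wd x t) \<and> ctrans (Wd x t) = Wd x t"
    and T: "\<And>x t. (x, t) \<in> U \<Longrightarrow> ctrans (T x t) = T x t"
    and W_t: "\<And>x t. (x, t) \<in> U \<Longrightarrow> has_dt W (Wd x t) x t"
    and Wd_x: "\<And>x t. (x, t) \<in> U \<Longrightarrow> has_dx Wd ((1/2) *\<^sub>C (W x t ** T x t + T x t ** W x t)) x t"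
    and T_x: "\<And>x t. (x, t) \<in> U \<Longrightarrow>
      has_dx T (((-1)^p / 2) *\<^sub>C (W x t ** Wd x t + Wd x t ** W x t)) x t"
  shows "dispersionless p U v r1 r2" "selfadjoint_on U r1" "selfadjoint_on U r2"
proof -
  have W_block: "W x t = Vmat v x t" and r1: "r1 x t = row_I0 ** T x t ** ctrans row_I0"
    and r2: "r2 x t = ctrans col_0I ** T x t ** col_0I" if "(x, t) \<in> U" for x t
  proof -
    show "W x t = Vmat v x t"
      using off_diag_adjoint_eq[OF conjunct1[OF W[OF that]] conjunct2[OF W[OF that]]] v[OF that]
      by (simp add: Vmat_def)
    show "r1 x t = row_I0 ** T x t ** ctrans row_I0" "r2 x t = ctrans col_0I ** T x t ** col_0I"
      unfolding r[OF that, symmetric] Rmat_def block_mat_blocks by simp_all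
  qed
  have v_t: "has_dt v (row_I0 ** Wd x t ** col_0I) x t" if xt: "(x, t) \<in> U" for x t
    unfolding has_dt_def
  proof (rule has_vector_derivative_transform_eventually)
    show "((\<lambda>s. row_I0 ** W x s ** col_0I) has_vector_derivative row_I0 ** Wd x t ** col_0I) (at t)"
      by (rule has_vector_derivative_sandwich[OF W_t[OF xt, unfolded has_dt_def]])
    show "\<forall>\<^sub>F s in nhds t. row_I0 ** W x s ** col_0I = v x s"
      using conjunct2[OF U[OF xt]] by eventually_elim (simp add: v)
  qed
  note dt_v = has_dt_imp_dt_eq[OF v_t]
  have Wd_block: "Wd x t = Vmat (dt v) x t" if "(x, t) \<in> U" for x t
    using off_diag_adjoint_eq[OF conjunct1[OF Wd[OF that]] conjunct2[OF Wd[OF that]]]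
    by (simp add: Vmat_def dt_v[OF that])
  show "selfadjoint_on U r1" "selfadjoint_on U r2"
    using T unfolding selfadjoint_on_def
    by (auto simp: r1 r2 matrix_mul_assoc)
  show "dispersionless p U v r1 r2"
    unfolding dispersionless_def
  proof (intro ballI, clarify, intro conjI)
    fix x t assume xt: "(x, t) \<in> U"
    note v' = v_t[OF xt, folded dt_v[OF xt], unfolded has_dt_def]
    note v_adj = has_vector_derivative_ctrans[OF v']
    show "(\<lambda>s. v x s) differentiable (at t)" using v' by (rule differentiableI_vector)
    have "((\<lambda>y. dt v y t) has_vector_derivative
        row_I0 ** ((1/2) *\<^sub>C (W x t ** T x t + T x t ** W x t)) ** col_0I) (at x)"
    proof (rule has_vector_derivative_transform_eventually)
      show "((\<lambda>y. row_I0 ** Wd y t ** col_0I) has_vector_derivative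
          row_I0 ** ((1/2) *\<^sub>C (W x t ** T x t + T x t ** W x t)) ** col_0I) (at x)"
        by (rule has_vector_derivative_sandwich[OF Wd_x[OF xt, unfolded has_dx_def]])
      show "\<forall>\<^sub>F y in nhds x. row_I0 ** Wd y t ** col_0I = dt v y t"
        using conjunct1[OF U[OF xt]] by eventually_elim (simp add: dt_v)
    qed
    then show "has_dx (dt v) ((1/2) *\<^sub>R (r1 x t ** v x t + v x t ** r2 x t)) x t"
      unfolding has_dx_def W_block[OF xt] r[OF xt, symmetric] Rmat_def Vmat_def
        block_mat_simps block_mat_blocks
      by (simp add: scaleR_eq_cscale mat_expand add.commute)
    have "has_dt (\<lambda>y s. v y s ** ctrans (v y s))
        (v x t ** ctrans (dt v x t) + dt v x t ** ctrans (v x t)) x t"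
      and "has_dt (\<lambda>y s. ctrans (v y s) ** v y s)
        (ctrans (v x t) ** dt v x t + ctrans (dt v x t) ** v x t) x t"
      unfolding has_dt_def by (rule has_vector_derivative_matrix_mult[OF v' v_adj]
        has_vector_derivative_matrix_mult[OF v_adj v'])+
    note products = this[THEN has_dt_imp_dt_eq]
    have T_blocks: "((-1)^p / 2) *\<^sub>C (W x t ** Wd x t + Wd x t ** W x t)
        = block_mat (((-1)^p / 2) *\<^sub>R dt (\<lambda>y s. v y s ** ctrans (v y s)) x t) 0
            0 (((-1)^p / 2) *\<^sub>R dt (\<lambda>y s. ctrans (v y s) ** v y s) x t)"
      unfolding products W_block[OF xt] Wd_block[OF xt] Vmat_def block_mat_simps block_mat_eq_iff
      by (simp add: scaleR_eq_cscale mat_expand)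
    note T' = has_vector_derivative_sandwich[OF T_x[OF xt, unfolded has_dx_def T_blocks]]
    show "has_dx r1 (((-1)^p / 2) *\<^sub>R dt (\<lambda>y s. v y s ** ctrans (v y s)) x t) x t"
      unfolding has_dx_def
    proof (rule has_vector_derivative_transform_eventually)
      show "\<forall>\<^sub>F y in nhds x. row_I0 ** T y t ** ctrans row_I0 = r1 y t"
        using conjunct1[OF U[OF xt]] by eventually_elim (simp add: r1)
    qed (use T'[of row_I0 "ctrans row_I0"] in \<open>simp only: block_mat_blocks\<close>)
    show "has_dx r2 (((-1)^p / 2) *\<^sub>R dt (\<lambda>y s. ctrans (v y s) ** v y s) x t) x t"
      unfolding has_dx_def
    proof (rule has_vector_derivative_transform_eventually)
      show "\<forall>\<^sub>F y in nhds x. ctrans col_0I ** T y t ** col_0I = r2 y t"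
        using conjunct1[OF U[OF xt]] by eventually_elim (simp add: r2)
    qed (use T'[of "ctrans col_0I" col_0I] in \<open>simp only: block_mat_blocks\<close>)
  qed
qed

section \<open>The transformed solution and its Darboux matrix\<close>

theorem corollary2p5:
  fixes a1 a2 b1 b2 :: ereal
    and p :: nat
    and v vt :: "real \<Rightarrow> real \<Rightarrow> complex^('m2::finite)^('m1::finite)"
    and \<rho>1 \<rho>1t :: "real \<Rightarrow> real \<Rightarrow> complex^'m1^'m1"
    and \<rho>2 \<rho>2t :: "real \<Rightarrow> real \<Rightarrow> complex^'m2^'m2"
    and A :: "complex^'n^'n"
    and P :: "real \<Rightarrow> real \<Rightarrow> complex^('m1 + 'm2)^'n"
    and S :: "real \<Rightarrow> real \<Rightarrow> complex^'n^'n"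
  defines "D \<equiv> rect a1 a2 b1 b2"
    and "V \<equiv> Vmat v"
    and "R \<equiv> Rmat \<rho>1 \<rho>2"
    and "DS \<equiv> {(x, t) \<in> rect a1 a2 b1 b2. invertible (S x t)}"
    and "Vt \<equiv> V_tilde (Vmat v) P S"
    and "Qt \<equiv> Qm1_tilde p (Vmat v) (Rmat \<rho>1 \<rho>2) A P S"
    and "Rt \<equiv> Rmat \<rho>1t \<rho>2t"
  assumes "a1 < 0" "0 < a2" "b1 < 0" "0 < b2"
    and "p \<in> {0, 1}"
    and "dispersionless p D v \<rho>1 \<rho>2"
    and "selfadjoint_on D \<rho>1" "selfadjoint_on D \<rho>2"
    and "continuous_on D (\<lambda>(x, t). dt v x t)"
    and "det A \<noteq> 0"
    and "S 0 0 = ctrans (S 0 0)" "det (S 0 0) \<noteq> 0"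
    and "A ** S 0 0 - S 0 0 ** ctrans A
           = \<i> *\<^sub>C (P 0 0 ** mpow jmat (p + 1) ** ctrans (P 0 0))"
    and "Pi_system p D V R A P"
    and "S_system p D V R A P S"
    and "\<And>x t. (x, t) \<in> DS \<Longrightarrow> vt x t = row_I0 ** Vt x t ** col_0I"
    and "\<And>x t. (x, t) \<in> DS \<Longrightarrow>
           block_mat (\<rho>1t x t) 0 0 (\<rho>2t x t)
             = (1 / (2 * \<i>)) *\<^sub>C (Qt x t ** jmat + jmat ** Qt x t)"
  shows "dispersionless p DS vt \<rho>1t \<rho>2t
    \<and> selfadjoint_on DS \<rho>1t \<and> selfadjoint_on DS \<rho>2t
    \<and> (\<forall>l. l \<notin> {0} \<union> spectrum A \<longrightarrow>
         (\<forall>U \<subseteq> DS. \<forall>w :: real \<Rightarrow> real \<Rightarrow> complex^'k^('m1 + 'm2).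
            solves_aux U (aux_G p V l) (aux_F p V R l) w \<longrightarrow>
            solves_aux U (aux_G p Vt l) (aux_F p Vt Rt l)
              (\<lambda>x t. w_A p A P S x t l ** w x t)))"
proof -
  \<comment> \<open>The exponent in \<open>K = j^(p+1)\<close> must stay \<open>p + 1\<close>: rewritten to \<open>Suc p\<close> it would no longer match
      the interpreted locale parameter.\<close>
  note One_nat_def [simp del]
  let ?\<epsilon> = "(-1) ^ p :: complex"
  let ?j = "jmat :: complex^('m1 + 'm2)^('m1 + 'm2)"
  let ?J = "mpow ?j p" let ?K = "mpow ?j (p + 1)"
  note p = \<open>p \<in> {0, 1}\<close> and disp = \<open>dispersionless p D v \<rho>1 \<rho>2\<close>
  note \<rho>_adj = \<open>selfadjoint_on D \<rho>1\<close> \<open>selfadjoint_on D \<rho>2\<close>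
  interpret signature ?j ?J ?K ?\<epsilon> by (rule jmat_signature[OF p])
  have D_line: "(\<forall>\<^sub>F y in nhds x. (y, t) \<in> D) \<and> (\<forall>\<^sub>F s in nhds t. (x, s) \<in> D)"
    if "(x, t) \<in> D" for x t
    using eventually_rect that unfolding D_def by blast
  have A_inv: "invertible A" using \<open>det A \<noteq> 0\<close> by (simp add: invertible_det_nz)

  have V_t: "has_dt V (dt V x t) x t" "dt V x t = Vmat (dt v) x t"
    and Vd_x: "has_dx (dt V) ((1/2) *\<^sub>C (V x t ** R x t + R x t ** V x t)) x t"
    and R_x: "has_dx R ((?\<epsilon> / 2) *\<^sub>C (V x t ** dt V x t + dt V x t ** V x t)) x t"
    if "(x, t) \<in> D" for x t
  proof -
    note form = dispersionless_matrix_form[OF disp that _ _ conjunct1[OF D_line[OF that]],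
        folded V_def R_def]
    have r: "ctrans (\<rho>1 x t) = \<rho>1 x t" "ctrans (\<rho>2 x t) = \<rho>2 x t"
      using \<rho>_adj that by (auto simp: selfadjoint_on_def)
    have eq: "dt V x t = Vmat (dt v) x t" by (rule has_dt_imp_dt_eq[OF form(1)[OF r]])
    show "has_dt V (dt V x t) x t" "dt V x t = Vmat (dt v) x t"
      "has_dx (dt V) ((1/2) *\<^sub>C (V x t ** R x t + R x t ** V x t)) x t"
      "has_dx R ((?\<epsilon> / 2) *\<^sub>C (V x t ** dt V x t + dt V x t ** V x t)) x t"
      using form[OF r] unfolding eq by simp_all
  qed
  have coeff: "darboux_coefficients ?j ?J ?K ?\<epsilon> A (V x t) (R x t) (dt V x t)"
    if "(x, t) \<in> D" for x t
  proof
    show "ctrans (R x t) = R x t"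
      using \<rho>_adj that by (auto simp: R_def Rmat_def block_mat_simps selfadjoint_on_def block_mat_eq_iff)
  qed (use A_inv that V_t(2) in \<open>simp_all add: V_def Vmat_def R_def Rmat_def block_mat_simps
      off_diag_block_mat diag_block_mat\<close>)
  have P_x: "has_dx P (darboux_coefficients.Px ?j ?K A (P x t) (V x t)) x t"
    and P_t: "has_dt P (darboux_coefficients.Pt ?j ?J A (P x t) (R x t) (dt V x t)) x t"
    and S_x: "has_dx S (darboux_coefficients.Sx ?J (P x t)) x t"
    and S_t: "has_dt S (darboux_coefficients.St ?j ?J ?\<epsilon> A (P x t) (R x t) (dt V x t)) x t"
    if "(x, t) \<in> D" for x t
  proof -
    interpret darboux_coefficients ?j ?J ?K ?\<epsilon> A "P x t" "V x t" "R x t" "dt V x t"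
      by (rule coeff[OF that])
    show "has_dx P Px x t" "has_dt P Pt x t" "has_dx S Sx x t" "has_dt S St x t"
      using \<open>Pi_system p D V R A P\<close> \<open>S_system p D V R A P S\<close> that
      unfolding Pi_system_def S_system_def Px_def Pt_def Sx_def St_def Q_def M_def q1_def q0_def
        Qm1_def scaleR_eq_cscale
      by (auto simp: power_add)
  qed

  \<comment> \<open>Self-adjointness and the Lyapunov identity propagate from the origin.\<close>
  have "(0, 0) \<in> D"
    using \<open>a1 < 0\<close> \<open>0 < a2\<close> \<open>b1 < 0\<close> \<open>0 < b2\<close> by (simp add: D_def rect_def zero_ereal_def)
  have S_adj: "ctrans (S x t) = S x t" if "(x, t) \<in> D" for x t
  proof -
    have "S x t - ctrans (S x t) = S 0 0 - ctrans (S 0 0)"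
    proof (rule constant_on_rect[of a1 a2 b1 b2 "\<lambda>x t. S x t - ctrans (S x t)"])
      fix x t assume "(x, t) \<in> rect a1 a2 b1 b2"
      then have xt: "(x, t) \<in> D" by (simp add: D_def)
      interpret darboux_coefficients ?j ?J ?K ?\<epsilon> A "P x t" "V x t" "R x t" "dt V x t"
        by (rule coeff[OF xt])
      show "has_dx (\<lambda>x t. S x t - ctrans (S x t)) 0 x t"
        using S_x[OF xt] has_vector_derivative_diff[OF _ has_vector_derivative_ctrans] Sx_adj
        unfolding has_dx_def by fastforce
      show "has_dt (\<lambda>x t. S x t - ctrans (S x t)) 0 x t"
        using S_t[OF xt] has_vector_derivative_diff[OF _ has_vector_derivative_ctrans] St_adj
        unfolding has_dt_def by fastforce
    qed (use \<open>(0, 0) \<in> D\<close> that in \<open>simp_all add: D_def\<close>)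
    then show ?thesis using \<open>S 0 0 = ctrans (S 0 0)\<close> by simp
  qed
  have lyapunov: "A ** S x t - S x t ** ctrans A = \<i> *\<^sub>C (P x t ** ?K ** ctrans (P x t))"
    if "(x, t) \<in> D" for x t
  proof -
    let ?f = "\<lambda>x t. (A ** S x t - S x t ** ctrans A) - \<i> *\<^sub>C (P x t ** ?K ** ctrans (P x t))"
    have der: "((\<lambda>y. (A ** Sf y - Sf y ** ctrans A) - \<i> *\<^sub>C (Pf y ** ?K ** ctrans (Pf y)))
        has_vector_derivative (A ** S' - S' ** ctrans A)
          - \<i> *\<^sub>C (P' ** ?K ** ctrans (Pf s) + Pf s ** ?K ** ctrans P')) (at s)"
      if S': "(Sf has_vector_derivative S') (at s)" and P': "(Pf has_vector_derivative P') (at s)"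
      for Sf S' Pf P' s
      by (rule has_vector_derivative_eq_rhs[OF has_vector_derivative_diff[OF has_vector_derivative_diff[OF
         has_vector_derivative_matrix_mult[OF has_vector_derivative_const S']
         has_vector_derivative_matrix_mult[OF S' has_vector_derivative_const]]
         has_vector_derivative_cscale[OF has_vector_derivative_matrix_mult[OF
           has_vector_derivative_matrix_mult[OF P' has_vector_derivative_const]
           has_vector_derivative_ctrans[OF P']]]]]) (simp add: mat_expand add.commute)
    have "?f x t = ?f 0 0"
    proof (rule constant_on_rect[of a1 a2 b1 b2 ?f])
      fix x t assume "(x, t) \<in> rect a1 a2 b1 b2"
      then have xt: "(x, t) \<in> D" by (simp add: D_def)
      interpret darboux_coefficients ?j ?J ?K ?\<epsilon> A "P x t" "V x t" "R x t" "dt V x t"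
        by (rule coeff[OF xt])
      show "has_dx ?f 0 x t"
        using der[OF S_x[OF xt, unfolded has_dx_def] P_x[OF xt, unfolded has_dx_def]]
        by (simp add: has_dx_def lyapunov_x)
      show "has_dt ?f 0 x t"
        using der[OF S_t[OF xt, unfolded has_dt_def] P_t[OF xt, unfolded has_dt_def]]
        by (simp add: has_dt_def lyapunov_t)
    qed (use \<open>(0, 0) \<in> D\<close> that in \<open>simp_all add: D_def\<close>)
    then show ?thesis using \<open>A ** S 0 0 - S 0 0 ** ctrans A = _\<close> by simp
  qed

  have DS_D: "(x, t) \<in> D" and S_inv: "invertible (S x t)" if "(x, t) \<in> DS" for x t
    using that by (auto simp: DS_def D_def)
  have point: "darboux_point ?j ?J ?K ?\<epsilon> A (P x t) (V x t) (R x t) (dt V x t) (S x t)"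
    if "(x, t) \<in> DS" for x t
    using coeff[OF DS_D[OF that]] S_inv[OF that] S_adj[OF DS_D[OF that]] lyapunov[OF DS_D[OF that]]
    by (intro darboux_point.intro darboux_point_axioms.intro)
  have DS_line: "(\<forall>\<^sub>F y in nhds x. (y, t) \<in> DS) \<and> (\<forall>\<^sub>F s in nhds t. (x, s) \<in> DS)"
    if xt: "(x, t) \<in> DS" for x t
  proof -
    have "isCont (\<lambda>y. S y t) x" "isCont (S x) t"
      using S_x[OF DS_D[OF xt]] S_t[OF DS_D[OF xt]] has_vector_derivative_continuous
      unfolding has_dx_def has_dt_def by blast+
    from this[THEN eventually_invertible] D_line[OF DS_D[OF xt]] S_inv[OF xt]
    show ?thesis by (auto simp: DS_def D_def elim: eventually_elim2)
  qed

  have Qt_eq: "Qt x t = darboux_point.Q' ?j ?J ?K A (P x t) (R x t) (dt V x t) (S x t)"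
    and Vt_eq: "Vt x t = darboux_point.V' ?j (P x t) (V x t) (S x t)" if xt: "(x, t) \<in> DS" for x t
  proof -
    interpret darboux_point ?j ?J ?K ?\<epsilon> A "P x t" "V x t" "R x t" "dt V x t" "S x t"
      by (rule point[OF xt])
    show "Qt x t = Q'"
      unfolding Qt_def Qm1_tilde_def Q'_def w0_def w0_inv_def B_def Q_def matrix_inv_ctrans[OF A_inv]
      unfolding V_def R_def by (rule refl)
    show "Vt x t = V'"
      unfolding Vt_def V_tilde_def V'_def X_def unfolding V_def by (simp add: matrix_mul_assoc)
  qed

  \<comment> \<open>\<open>Wd\<close> and \<open>T\<close> are the candidates for \<open>V'\<^sub>t\<close> and \<open>R'\<close>, cut out of \<open>Q'\<close> as functions of \<open>(x, t)\<close>.\<close>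
  define Wd where "Wd x t = (- 1 / 2) *\<^sub>C (?J ** (Qt x t - ?j ** Qt x t ** ?j))" for x t
  define T where "T x t = (1 / (2 * \<i>)) *\<^sub>C (Qt x t ** ?j + ?j ** Qt x t)" for x t
  have Rt_T: "Rt x t = T x t" if "(x, t) \<in> DS" for x t
    using assms(24)[OF that] by (simp add: Rt_def Rmat_def T_def)
  have facts: "Vt x t ** ?j = - (?j ** Vt x t) \<and> ctrans (Vt x t) = Vt x t"
    "Wd x t ** ?j = - (?j ** Wd x t) \<and> ctrans (Wd x t) = Wd x t"
    "ctrans (T x t) = T x t" "has_dt Vt (Wd x t) x t"
    "has_dx Qt ((- \<i> / 2) *\<^sub>C (?K ** Vt x t ** Qt x t - Qt x t ** ?K ** Vt x t)) x t"
    "Qt x t = \<i> *\<^sub>C (?j ** T x t) - ?J ** Wd x t"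
    "T x t ** ?j = ?j ** T x t"
    if xt: "(x, t) \<in> DS" for x t
  proof -
    note xtD = DS_D[OF xt]
    interpret darboux_point ?j ?J ?K ?\<epsilon> A "P x t" "V x t" "R x t" "dt V x t" "S x t"
      by (rule point[OF xt])
    note Qt = Qt_eq[OF xt] and Vt = Vt_eq[OF xt]
    have Wd: "Wd x t = Vd'" by (simp add: Wd_def Vd'_def Qt)
    have T: "T x t = R'" by (simp add: T_def R'_def Qt)
    show "Vt x t ** ?j = - (?j ** Vt x t) \<and> ctrans (Vt x t) = Vt x t"
      by (simp add: Vt V'_off V'_adj)
    show "Wd x t ** ?j = - (?j ** Wd x t) \<and> ctrans (Wd x t) = Wd x t"
      by (simp add: Wd Vd'_off Vd'_adj)
    show "ctrans (T x t) = T x t" "T x t ** ?j = ?j ** T x t"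
      by (simp_all add: T R'_adj R'_diag)
    show "Qt x t = \<i> *\<^sub>C (?j ** T x t) - ?J ** Wd x t"
      by (simp only: T Wd Qt Q'_split)
    have "((\<lambda>s. V x s + (\<i> / 2) *\<^sub>C (?j ** (ctrans (P x s) ** matrix_inv (S x s) ** P x s)
      - ctrans (P x s) ** matrix_inv (S x s) ** P x s ** ?j)) has_vector_derivative Vd') (at t)"
      by (rule has_vector_derivative_V'_t[OF P_t[OF xtD, unfolded has_dt_def] refl
            S_t[OF xtD, unfolded has_dt_def] refl V_t(1)[OF xtD, unfolded has_dt_def]])
    then show "has_dt Vt (Wd x t) x t"
      by (simp add: has_dt_def Wd Vt_def V_tilde_def[abs_def] V_def matrix_mul_assoc)
    \<comment> \<open>The Darboux matrix at \<open>\<lambda> = 0\<close> along the \<open>x\<close>-line; \<open>0\<close> is not an eigenvalue of \<open>A\<close>.\<close>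
    let ?w = "\<lambda>y. mat 1 - \<i> *\<^sub>C (?K ** ctrans (P y t) ** matrix_inv (S y t)
      ** matrix_inv (A - mat 0) ** P y t)"
    let ?Q = "\<lambda>y. \<i> *\<^sub>C (?j ** R y t) - ?J ** dt V y t"
    have w_x: "(?w has_vector_derivative
      (- (\<i> / 2) *\<^sub>C (?K ** V')) ** w0 - w0 ** (- (\<i> / 2) *\<^sub>C (?K ** V x t))) (at x)"
      using has_vector_derivative_w_x[OF P_x[OF xtD, unfolded has_dx_def] refl
          S_x[OF xtD, unfolded has_dx_def] refl, of 0] A_inv
      by (simp add: w_0 cscale_zero cscale_collect)
    have Q_x: "(?Q has_vector_derivative
      (- \<i> / 2) *\<^sub>C (?K ** V x t ** Q - Q ** ?K ** V x t)) (at x)"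
      unfolding zero_curvature[OF V_off Vd_off R_diag Q_def, symmetric]
      by (rule has_vector_derivative_eq_rhs[OF has_vector_derivative_diff[OF
        has_vector_derivative_cscale[OF has_vector_derivative_matrix_mult[OF
          has_vector_derivative_const R_x[OF xtD, unfolded has_dx_def]]]
        has_vector_derivative_matrix_mult[OF
          has_vector_derivative_const Vd_x[OF xtD, unfolded has_dx_def]]]]) simp
    have "((\<lambda>y. ?w y ** ?Q y ** matrix_inv (?w y)) has_vector_derivative
      (- \<i> / 2) *\<^sub>C (?K ** V' ** Q' - Q' ** ?K ** V')) (at x)"
      by (rule has_vector_derivative_Q'_x[OF w_x _ Q_x]) (simp_all add: w0_def B_def Q_def)
    moreover have "\<forall>\<^sub>F y in nhds x. ?w y ** ?Q y ** matrix_inv (?w y) = Qt y t"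
      using conjunct1[OF DS_line[OF xt]]
    proof eventually_elim
      case (elim y)
      interpret y: darboux_point ?j ?J ?K ?\<epsilon> A "P y t" "V y t" "R y t" "dt V y t" "S y t"
        by (rule point[OF elim])
      have "?w y = y.w0" by (simp add: y.w0_def y.B_def)
      then show ?case
        by (simp only: y.matrix_inv_w0 Qt_eq[OF elim] y.Q'_def y.Q_def)
    qed
    ultimately show "has_dx Qt ((- \<i> / 2) *\<^sub>C (?K ** Vt x t ** Qt x t - Qt x t ** ?K ** Vt x t)) x t"
      unfolding has_dx_def Vt Qt by (rule has_vector_derivative_transform_eventually)
  qed
  have Qt_x: "has_dx Qt (\<i> *\<^sub>C (?j ** ((?\<epsilon> / 2) *\<^sub>C (Vt x t ** Wd x t + Wd x t ** Vt x t)))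
      - ?J ** ((1 / 2) *\<^sub>C (Vt x t ** T x t + T x t ** Vt x t))) x t" (is "has_dx Qt ?Qx x t")
    and T_x: "has_dx T ((?\<epsilon> / 2) *\<^sub>C (Vt x t ** Wd x t + Wd x t ** Vt x t)) x t"
    and Wd_x: "has_dx Wd ((1 / 2) *\<^sub>C (Vt x t ** T x t + T x t ** Vt x t)) x t"
    if xt: "(x, t) \<in> DS" for x t
  proof -
    note f = facts[OF xt]
    show Q: "has_dx Qt ?Qx x t"
      using f(5) zero_curvature[OF conjunct1[OF f(1)] conjunct1[OF f(2)] f(7) f(6)] by simp
    note Q = Q[unfolded has_dx_def]
    note parts = zero_curvature_blocks[OF conjunct1[OF f(1)] conjunct1[OF f(2)] f(7) refl]
    have "((\<lambda>y. (1 / (2 * \<i>)) *\<^sub>C (Qt y t ** ?j + ?j ** Qt y t))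
        has_vector_derivative (1 / (2 * \<i>)) *\<^sub>C (?Qx ** ?j + ?j ** ?Qx)) (at x)"
      by (rule has_vector_derivative_eq_rhs[OF has_vector_derivative_cscale[OF
          has_vector_derivative_add[OF
            has_vector_derivative_matrix_mult[OF Q has_vector_derivative_const]
            has_vector_derivative_matrix_mult[OF has_vector_derivative_const Q]]]]) simp
    then show "has_dx T ((?\<epsilon> / 2) *\<^sub>C (Vt x t ** Wd x t + Wd x t ** Vt x t)) x t"
      unfolding has_dx_def parts(1) by (simp only: T_def)
    have "((\<lambda>y. (- 1 / 2) *\<^sub>C (?J ** (Qt y t - ?j ** Qt y t ** ?j)))
        has_vector_derivative (- 1 / 2) *\<^sub>C (?J ** (?Qx - ?j ** ?Qx ** ?j))) (at x)"
      by (rule has_vector_derivative_eq_rhs[OF has_vector_derivative_cscale[OF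
          has_vector_derivative_matrix_mult[OF has_vector_derivative_const
          has_vector_derivative_diff[OF Q has_vector_derivative_sandwich[OF Q]]]]]) simp
    then show "has_dx Wd ((1 / 2) *\<^sub>C (Vt x t ** T x t + T x t ** Vt x t)) x t"
      unfolding has_dx_def parts(2) by (simp only: Wd_def)
  qed
  have "dispersionless p DS vt \<rho>1t \<rho>2t" "selfadjoint_on DS \<rho>1t" "selfadjoint_on DS \<rho>2t"
    using dispersionlessI_matrix_form[OF DS_line assms(23) Rt_T[unfolded Rt_def] facts(1,2,3,4) Wd_x T_x]
    by blast+
  moreover
  have "solves_aux U (aux_G p Vt l) (aux_F p Vt Rt l) (\<lambda>x t. w_A p A P S x t l ** u x t)"
    if l: "l \<notin> {0} \<union> spectrum A" and U: "U \<subseteq> DS"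
      and u: "solves_aux U (aux_G p V l) (aux_F p V R l) u"
    for l U and u :: "real \<Rightarrow> real \<Rightarrow> complex^'k^('m1 + 'm2)"
    unfolding solves_aux_def
  proof (intro ballI, clarify)
    fix x t assume xtU: "(x, t) \<in> U"
    then have xt: "(x, t) \<in> DS" using U by blast
    note xtD = DS_D[OF xt] and f = facts[OF xt]
    have l': "invertible (A - mat l)" "l \<noteq> 0" using l by (auto simp: spectrum_def)
    interpret darboux_point ?j ?J ?K ?\<epsilon> A "P x t" "V x t" "R x t" "dt V x t" "S x t"
      by (rule point[OF xt])
    note Qt = Qt_eq[OF xt] and Vt = Vt_eq[OF xt]
    have wA: "w_A p A P S x t l = w l" by (simp add: w_A_def w_def B_def)
    have G: "aux_G p V l x t = (\<i> / 4 * l) *\<^sub>C ?j - (\<i> / 2) *\<^sub>C (?K ** V x t)"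
      "aux_G p Vt l x t = (\<i> / 4 * l) *\<^sub>C ?j - (\<i> / 2) *\<^sub>C (?K ** V')"
      by (simp_all add: aux_G_def Vt)
    have F: "aux_F p V R l x t = (- 1 / l) *\<^sub>C Q"
      by (simp add: aux_F_def Q_def vec_eq_iff algebra_simps)
    have Vt_t: "dt Vt x t = Wd x t" by (rule has_dt_imp_dt_eq[OF f(4)])
    have Ft: "aux_F p Vt Rt l x t = (- 1 / l) *\<^sub>C Q'"
      unfolding Qt[symmetric] f(6) aux_F_def Rt_T[OF xt] Vt_t
      by (simp add: vec_eq_iff algebra_simps)
    \<comment> \<open>If \<open>w' = Z' w - w Z\<close> and \<open>u' = Z u\<close>, then \<open>(w u)' = Z' (w u)\<close>.\<close>
    have product: "((\<lambda>y. Wf y ** uf y) has_vector_derivative Z' ** (w l ** uf s)) (at s)"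
      if "(Wf has_vector_derivative Z' ** w l - w l ** Z) (at s)" "Wf s = w l"
        "(uf has_vector_derivative Z ** uf s) (at s)"
      for Wf :: "real \<Rightarrow> complex^('m1 + 'm2)^('m1 + 'm2)" and uf :: "real \<Rightarrow> complex^'k^('m1 + 'm2)"
        and Z Z' s
      by (rule has_vector_derivative_eq_rhs[OF has_vector_derivative_matrix_mult[OF that(1,3)]])
        (simp add: that(2) mat_expand)
    show "has_dx (\<lambda>x t. w_A p A P S x t l ** u x t)
        (aux_G p Vt l x t ** (w_A p A P S x t l ** u x t)) x t \<and>
      has_dt (\<lambda>x t. w_A p A P S x t l ** u x t)
        (aux_F p Vt Rt l x t ** (w_A p A P S x t l ** u x t)) x t"
      unfolding has_dx_def has_dt_def wA G Ft
    proof (intro conjI product)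
      show "((\<lambda>y. w_A p A P S y t l) has_vector_derivative
        ((\<i> / 4 * l) *\<^sub>C ?j - (\<i> / 2) *\<^sub>C (?K ** V')) ** w l - w l ** aux_G p V l x t) (at x)"
        unfolding G w_A_def
        by (rule has_vector_derivative_w_x[OF P_x[OF xtD, unfolded has_dx_def] refl
          S_x[OF xtD, unfolded has_dx_def] refl l'(1)])
      show "((\<lambda>s. w_A p A P S x s l) has_vector_derivative
        ((- 1 / l) *\<^sub>C Q') ** w l - w l ** aux_F p V R l x t) (at t)"
        unfolding F w_A_def
        by (rule has_vector_derivative_w_t[OF P_t[OF xtD, unfolded has_dt_def] refl
          S_t[OF xtD, unfolded has_dt_def] refl l'])
      show "((\<lambda>y. u y t) has_vector_derivative aux_G p V l x t ** u x t) (at x)"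
        "(u x has_vector_derivative aux_F p V R l x t ** u x t) (at t)"
        using u xtU by (auto simp: solves_aux_def has_dx_def has_dt_def)
    qed (simp_all add: wA)
  qed
  ultimately show ?thesis by blast
qed

end
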